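(* In the setting described in the context, for $(h,H)\in\mathbf{R}^d\times\mathbf{S}^d$ set $$\widehat\Psi_+(h,H)=\max_{(v,Z)\in V\times\mathcal{Z}}\ \inf_{\substack{\alpha>0,\\ -\gamma\alpha\Theta_*^{-1}\preceq H\preceq\gamma\alpha\Theta_*^{-1}}}\left\{\alpha\Phi\left(\tfrac h\alpha,\tfrac H\alpha;M(v),BZB^T\right)-G(v,Z)+\tfrac\alpha K\ln\left(\tfrac2\epsilon\right)\right\},$$ $$\widehat\Psi_-(h,H)=\max_{(v,Z)\in V\times\mathcal{Z}}\ \inf_{\substack{\alpha>0,\\ -\gamma\alpha\Theta_*^{-1}\preceq H\preceq\gamma\alpha\Theta_*^{-1}}}\left\{\alpha\Phi\left(-\tfrac h\alpha,-\tfrac H\alpha;M(v),BZB^T\right)+G(v,Z)+\tfrac\alpha K\ln\left(\tfrac2\epsilon\right)\right\}.$$ Then the functions $\widehat\Psi_\pm:\mathbf{R}^d\times\mathbf{S}^d\to\mathbf{R}$ are convex. Furthermore, whenever $\bar h,\bar H,\bar\rho,\bar\varkappa$ form a feasible solution to the system of convex constraints $$\widehat\Psi_+(h,H)\le\rho-\varkappa,\qquad\widehat\Psi_-(h,H)\le\rho+\varkappa$$ in variables $(h,H)\in\mathbf{R}^d\times\mathbf{S}^d$, $\rho\in\mathbf{R}$, $\varkappa\in\mathbf{R}$, the estimate $$\widehat g(\zeta^K)=\frac1K\sum_{i=1}^K\left[\bar h^T\zeta_i+\tfrac12\zeta_i^T\bar H\zeta_i\right]+\bar\varkappa,\qquad\zeta^K=(\zeta_1,\dots,\zeta_K),$$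 of $F(u,v)=[u;1]^TQ[u;1]+q^Tv$ via $K$ independent observations $\zeta_i\sim\mathcal{N}(A[u;1],M(v))$, $i=1,\dots,K$, has $\epsilon$-risk not exceeding $\bar\rho$: $$\forall(u,v)\in U\times V:\quad\mathrm{Prob}_{\zeta^K\sim[\mathcal{N}(A[u;1],M(v))]^K}\left\{|F(u,v)-\widehat g(\zeta^K)|>\bar\rho\right\}\le\epsilon.$$ In particular, for every $(\bar h,\bar H)\in\mathbf{R}^d\times\mathbf{S}^d$, setting $$\bar\rho=\tfrac12\left[\widehat\Psi_+(\bar h,\bar H)+\widehat\Psi_-(\bar h,\bar H)\right],\qquad\bar\varkappa=\tfrac12\left[\widehat\Psi_-(\bar h,\bar H)-\widehat\Psi_+(\bar h,\bar H)\right],$$ one obtains an estimate $\widehat g(\zeta^K)=\frac1K\sum_{i=1}^K\left[\bar h^T\zeta_i+\tfrac12\zeta_i^T\bar H\zeta_i\right]+\bar\varkappa$ with $\epsilon$-risk not exceeding $\bar\rho$.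
   Context: Notation: $\mathbf{S}^n$ is the space of real symmetric $n\times n$ matrices, $\mathbf{S}^n_+$ the cone of positive semidefinite ones; $[x;y]$ is vertical and $[X,Y]$ horizontal concatenation; $\|\cdot\|$ is the spectral norm, $\|\cdot\|_F$ the Frobenius norm. Data: positive integers $d,m,k,K$; $\epsilon\in(0,1)$; a nonempty bounded set $U\subset\mathbf{R}^m$; a nonempty convex compact set $V\subset\mathbf{R}^k$; an affine mapping $v\mapsto M(v):\mathbf{R}^k\to\mathbf{S}^d$ which maps $V$ onto a convex compact subset $\mathcal{V}=M(V)$ of $\mathbf{S}^d_+$; a $d\times(m+1)$ matrix $A$; $Q\in\mathbf{S}^{m+1}$ and $q\in\mathbf{R}^k$, defining $F(u,v)=[u;1]^TQ[u;1]+q^Tv$ and $G(v,Z)=\mathrm{Tr}(QZ)+q^Tv$ for $(v,Z)\in\mathbf{R}^k\times\mathbf{S}^{m+1}$. Chosen objects: a convex compact set $\mathcal{Z}\subset\{Z\in\mathbf{S}^{m+1}_+:Z_{m+1,m+1}=1\}$ with $[u;1][u;1]^T\in\mathcal{Z}$ for all $u\in U$; a positive definite matrix $\Theta_*\in\mathbf{S}^d$ and a real $\delta\in[0,2]$ such that $\Theta\preceq\Theta_*$ and $\|\Theta^{1/2}\Theta_*^{-1/2}-I\|\le\delta$ for all $\Theta\in\mathcal{V}$; a real $\gamma\in(0,1)$. Let $B=[A;e_{m+1}^T]$ be the $(d+1)\times(m+1)$ matrix obtained by appending to $A$ the transpose of the last standard basis vector of $\mathbf{R}^{m+1}$ as last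 row. The function $\Phi$: for $h\in\mathbf{R}^d$, $H\in\mathbf{S}^d$ with $-\gamma\Theta_*^{-1}\preceq H\preceq\gamma\Theta_*^{-1}$, $\Theta\in\mathcal{V}$, and $W\in\mathbf{S}^{d+1}_+$ with $W_{d+1,d+1}=1$, $$\Phi(h,H;\Theta,W)=-\tfrac12\ln\mathrm{Det}(I-\Theta_*^{1/2}H\Theta_*^{1/2})+\tfrac12\mathrm{Tr}([\Theta-\Theta_*]H)+\frac{\delta(2+\delta)}{2(1-\|\Theta_*^{1/2}H\Theta_*^{1/2}\|)}\|\Theta_*^{1/2}H\Theta_*^{1/2}\|_F^2$$ $$\qquad+\tfrac12\mathrm{Tr}\left(W\left[\begin{bmatrix} H & h \\ {h}^T & 0 \end{bmatrix}+[H,h]^T[\Theta_*^{-1}-H]^{-1}[H,h]\right]\right).$$ The $\epsilon$-risk of an estimate $\widehat g$ (a Borel function on $\mathbf{R}^{Kd}$) is the smallest $\rho$ such that $\mathrm{Prob}_{\zeta^K\sim[\mathcal{N}(A[u;1],M(v))]^K}\{|\widehat g(\zeta^K)-F(u,v)|>\rho\}\le\epsilon$ for all $(u,v)\in U\times V$, where $P^K$ denotes the distribution of an i.i.d. $K$-sample from $P$. *)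

theory Defs
  imports "HOL-Probability.Probability"
begin

text \<open>
  Real symmetric matrices are elements of \<open>real^'n^'n\<close> satisfying \<open>symmetric_mat\<close>.
  The index type \<open>'n + unit\<close> plays the role of \<open>{1, \<dots>, n + 1}\<close>, with \<open>Inr ()\<close> the last index.
\<close>

subsection \<open>Matrices\<close>

definition symmetric_mat :: "real^'n^'n \<Rightarrow> bool" where
  "symmetric_mat A \<longleftrightarrow> transpose A = A"

definition psd :: "real^'n^'n \<Rightarrow> bool" where
  "psd A \<longleftrightarrow> symmetric_mat A \<and> (\<forall>x. 0 \<le> x \<bullet> (A *v x))"

definition posdef :: "real^'n^'n \<Rightarrow> bool" where
  "posdef A \<longleftrightarrow> symmetric_mat A \<and> (\<forall>x. x \<noteq> 0 \<longrightarrow> 0 < x \<bullet> (A *v x))"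

definition loewner_le :: "real^'n^'n \<Rightarrow> real^'n^'n \<Rightarrow> bool"  (infix \<open>\<preceq>\<close> 50) where
  "A \<preceq> B \<longleftrightarrow> psd (B - A)"

text \<open>The positive semidefinite square root; meaningful for positive semidefinite arguments only.\<close>

definition psd_sqrt :: "real^'n^'n \<Rightarrow> real^'n^'n" where
  "psd_sqrt A = (THE R. psd R \<and> R ** R = A)"

definition spectral_norm :: "real^'n^'m \<Rightarrow> real" where
  "spectral_norm A = onorm (\<lambda>x. A *v x)"

definition frobenius_norm :: "real^'n^'m \<Rightarrow> real" where
  "frobenius_norm A = sqrt (\<Sum>i\<in>UNIV. \<Sum>j\<in>UNIV. (A $ i $ j)\<^sup>2)"

definition vec_snoc :: "real^'n \<Rightarrow> real \<Rightarrow> real^('n::finite + unit)" where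
  "vec_snoc u t = (\<chi> i. case i of Inl j \<Rightarrow> u $ j | Inr _ \<Rightarrow> t)"

definition append_col :: "real^'n^'m \<Rightarrow> real^'m \<Rightarrow> real^('n::finite + unit)^'m" where
  "append_col H h = (\<chi> i. vec_snoc (H $ i) (h $ i))"

definition append_row :: "real^'n^'m \<Rightarrow> real^'n \<Rightarrow> real^'n^('m::finite + unit)" where
  "append_row A r = (\<chi> i. case i of Inl j \<Rightarrow> A $ j | Inr _ \<Rightarrow> r)"

text \<open>The matrix \<open>[H, h; h\<^sup>T, 0]\<close>.\<close>

definition bordered :: "real^'n^'n \<Rightarrow> real^'n \<Rightarrow> real^('n::finite + unit)^('n::finite + unit)" where
  "bordered H h = append_row (append_col H h) (vec_snoc h 0)"

text \<open>The matrix \<open>B = [A; e\<^sup>T]\<close>, with \<open>e\<close> the last standard basis vector.\<close>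

definition append_basis_row :: "real^('m::finite + unit)^'d \<Rightarrow> real^('m::finite + unit)^('d::finite + unit)" where
  "append_basis_row A = append_row A (axis (Inr ()) 1)"

definition outer_square :: "real^'n \<Rightarrow> real^'n^'n" where
  "outer_square x = (\<chi> i j. x $ i * x $ j)"

definition affine_map :: "('a::real_vector \<Rightarrow> 'b::real_vector) \<Rightarrow> bool" where
  "affine_map f \<longleftrightarrow> (\<exists>L c. linear L \<and> (\<forall>x. f x = L x + c))"

subsection \<open>Gaussian distributions\<close>

definition std_gaussian :: "(real^'d) measure" where
  "std_gaussian = density lborel (\<lambda>x. ennreal (\<Prod>i\<in>UNIV. std_normal_density (x $ i)))"

text \<open>The covariance matrix may be singular, hence no density with respect to Lebesgue measure.\<close>

definition gaussian :: "real^'d \<Rightarrow> real^'d^'d \<Rightarrow> (real^'d) measure" where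
  "gaussian \<mu> \<Sigma> = distr std_gaussian borel (\<lambda>x. \<mu> + psd_sqrt \<Sigma> *v x)"

definition iid_sample :: "nat \<Rightarrow> 'a measure \<Rightarrow> (nat \<Rightarrow> 'a) measure" where
  "iid_sample K P = Pi\<^sub>M {..<K} (\<lambda>_. P)"

subsection \<open>The estimation problem\<close>

definition F_fun :: "real^('m::finite + unit)^('m::finite + unit) \<Rightarrow> real^'k \<Rightarrow> real^'m \<Rightarrow> real^'k \<Rightarrow> real" where
  "F_fun Q q u v = vec_snoc u 1 \<bullet> (Q *v vec_snoc u 1) + q \<bullet> v"

definition G_fun ::
  "real^('m::finite + unit)^('m::finite + unit) \<Rightarrow> real^'k \<Rightarrow> real^'k \<Rightarrow> real^('m::finite + unit)^('m::finite + unit) \<Rightarrow> real" where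
  "G_fun Q q v Z = trace (Q ** Z) + q \<bullet> v"

text \<open>
  \<open>risk_bound \<dots> g \<rho>\<close>: the error of \<open>g\<close> exceeds \<open>\<rho>\<close> with probability at most \<open>\<epsilon>\<close>, for all signals.
  It is meant for Borel functions \<open>g\<close>.
\<close>

definition risk_bound ::
  "nat \<Rightarrow> real \<Rightarrow> (real^'m) set \<Rightarrow> (real^'k) set \<Rightarrow> real^('m::finite + unit)^'d \<Rightarrow> (real^'k \<Rightarrow> real^'d^'d) \<Rightarrow>
   (real^'m \<Rightarrow> real^'k \<Rightarrow> real) \<Rightarrow> ((nat \<Rightarrow> real^'d) \<Rightarrow> real) \<Rightarrow> real \<Rightarrow> bool" where
  "risk_bound K \<epsilon> U V A M F g \<rho> \<longleftrightarrow>
     (\<forall>u\<in>U. \<forall>v\<in>V.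
        let P = iid_sample K (gaussian (A *v vec_snoc u 1) (M v))
        in measure P {\<zeta> \<in> space P. \<bar>F u v - g \<zeta>\<bar> > \<rho>} \<le> \<epsilon>)"

text \<open>
  For Borel \<open>g\<close> the infimum is attained whenever it is finite, since the probabilities above are
  right-continuous in \<open>\<rho>\<close>; the risk is \<open>\<infinity>\<close> if no real \<open>\<rho>\<close> qualifies.
\<close>

definition eps_risk ::
  "nat \<Rightarrow> real \<Rightarrow> (real^'m) set \<Rightarrow> (real^'k) set \<Rightarrow> real^('m::finite + unit)^'d \<Rightarrow> (real^'k \<Rightarrow> real^'d^'d) \<Rightarrow>
   (real^'m \<Rightarrow> real^'k \<Rightarrow> real) \<Rightarrow> ((nat \<Rightarrow> real^'d) \<Rightarrow> real) \<Rightarrow> ereal" where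
  "eps_risk K \<epsilon> U V A M F g = Inf (ereal ` {\<rho>. risk_bound K \<epsilon> U V A M F g \<rho>})"

definition quad_estimate ::
  "nat \<Rightarrow> real^'d \<Rightarrow> real^'d^'d \<Rightarrow> real \<Rightarrow> (nat \<Rightarrow> real^'d) \<Rightarrow> real" where
  "quad_estimate K h H \<kappa> \<zeta> =
     (1 / real K) * (\<Sum>i<K. h \<bullet> \<zeta> i + (1/2) * (\<zeta> i \<bullet> (H *v \<zeta> i))) + \<kappa>"

subsection \<open>The functions \<open>\<Phi>\<close> and \<open>\<Psi>\<close>\<close>

definition Phi ::
  "real^'d^'d \<Rightarrow> real \<Rightarrow> real^'d \<Rightarrow> real^'d^'d \<Rightarrow> real^'d^'d \<Rightarrow>
   real^('d::finite + unit)^('d::finite + unit) \<Rightarrow> real" where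
  "Phi \<Theta>s \<delta> h H \<Theta> W =
     (let S = psd_sqrt \<Theta>s ** H ** psd_sqrt \<Theta>s; C = append_col H h in
      - (1/2) * ln (det (mat 1 - S))
      + (1/2) * trace ((\<Theta> - \<Theta>s) ** H)
      + \<delta> * (2 + \<delta>) / (2 * (1 - spectral_norm S)) * (frobenius_norm S)\<^sup>2
      + (1/2) * trace (W ** (bordered H h
            + transpose C ** matrix_inv (matrix_inv \<Theta>s - H) ** C)))"

definition admissible :: "real \<Rightarrow> real^'d^'d \<Rightarrow> real^'d^'d \<Rightarrow> real set" where
  "admissible \<gamma> \<Theta>s H =
     {\<alpha>. 0 < \<alpha> \<and> - ((\<gamma> * \<alpha>) *\<^sub>R matrix_inv \<Theta>s) \<preceq> H \<and> H \<preceq> (\<gamma> * \<alpha>) *\<^sub>R matrix_inv \<Theta>s}"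

text \<open>
  \<open>max_inf S T f\<close> is written with real-valued suprema and infima; \<open>max_inf_proper S T f\<close> says that
  they are not degenerate: every inner infimum is a genuine (finite) one, and the outer supremum
  is a maximum.
\<close>

definition max_inf :: "'a set \<Rightarrow> 'b set \<Rightarrow> ('a \<Rightarrow> 'b \<Rightarrow> real) \<Rightarrow> real" where
  "max_inf S T f = (SUP p\<in>S. INF t\<in>T. f p t)"

definition max_inf_proper :: "'a set \<Rightarrow> 'b set \<Rightarrow> ('a \<Rightarrow> 'b \<Rightarrow> real) \<Rightarrow> bool" where
  "max_inf_proper S T f \<longleftrightarrow>
     T \<noteq> {} \<and> (\<forall>p\<in>S. bdd_below (f p ` T)) \<and>
     (\<exists>p\<in>S. max_inf S T f = (INF t\<in>T. f p t) \<and> (\<forall>p'\<in>S. (INF t\<in>T. f p' t) \<le> (INF t\<in>T. f p t)))"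

definition obj_plus ::
  "nat \<Rightarrow> real \<Rightarrow> real^'d^'d \<Rightarrow> real \<Rightarrow> (real^'k \<Rightarrow> real^'d^'d) \<Rightarrow> real^('m::finite + unit)^'d \<Rightarrow>
   real^('m::finite + unit)^('m::finite + unit) \<Rightarrow> real^'k \<Rightarrow> real^'d \<Rightarrow> real^'d^'d \<Rightarrow>
   (real^'k) \<times> (real^('m::finite + unit)^('m::finite + unit)) \<Rightarrow> real \<Rightarrow> real" where
  "obj_plus K \<epsilon> \<Theta>s \<delta> M A Q q h H = (\<lambda>(v, Z) \<alpha>. let B = append_basis_row A in
     \<alpha> * Phi \<Theta>s \<delta> (h /\<^sub>R \<alpha>) (H /\<^sub>R \<alpha>) (M v) (B ** Z ** transpose B)
     - G_fun Q q v Z + \<alpha> / real K * ln (2 / \<epsilon>))"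

definition obj_minus ::
  "nat \<Rightarrow> real \<Rightarrow> real^'d^'d \<Rightarrow> real \<Rightarrow> (real^'k \<Rightarrow> real^'d^'d) \<Rightarrow> real^('m::finite + unit)^'d \<Rightarrow>
   real^('m::finite + unit)^('m::finite + unit) \<Rightarrow> real^'k \<Rightarrow> real^'d \<Rightarrow> real^'d^'d \<Rightarrow>
   (real^'k) \<times> (real^('m::finite + unit)^('m::finite + unit)) \<Rightarrow> real \<Rightarrow> real" where
  "obj_minus K \<epsilon> \<Theta>s \<delta> M A Q q h H = (\<lambda>(v, Z) \<alpha>. let B = append_basis_row A in
     \<alpha> * Phi \<Theta>s \<delta> (- (h /\<^sub>R \<alpha>)) (- (H /\<^sub>R \<alpha>)) (M v) (B ** Z ** transpose B)
     + G_fun Q q v Z + \<alpha> / real K * ln (2 / \<epsilon>))"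

definition Psi_plus ::
  "nat \<Rightarrow> real \<Rightarrow> real \<Rightarrow> real^'d^'d \<Rightarrow> real \<Rightarrow> (real^'k) set \<Rightarrow> (real^('m::finite + unit)^('m::finite + unit)) set \<Rightarrow>
   (real^'k \<Rightarrow> real^'d^'d) \<Rightarrow> real^('m::finite + unit)^'d \<Rightarrow> real^('m::finite + unit)^('m::finite + unit) \<Rightarrow> real^'k \<Rightarrow>
   real^'d \<Rightarrow> real^'d^'d \<Rightarrow> real" where
  "Psi_plus K \<epsilon> \<gamma> \<Theta>s \<delta> V \<Z> M A Q q h H =
     max_inf (V \<times> \<Z>) (admissible \<gamma> \<Theta>s H) (obj_plus K \<epsilon> \<Theta>s \<delta> M A Q q h H)"

definition Psi_minus ::
  "nat \<Rightarrow> real \<Rightarrow> real \<Rightarrow> real^'d^'d \<Rightarrow> real \<Rightarrow> (real^'k) set \<Rightarrow> (real^('m::finite + unit)^('m::finite + unit)) set \<Rightarrow>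
   (real^'k \<Rightarrow> real^'d^'d) \<Rightarrow> real^('m::finite + unit)^'d \<Rightarrow> real^('m::finite + unit)^('m::finite + unit) \<Rightarrow> real^'k \<Rightarrow>
   real^'d \<Rightarrow> real^'d^'d \<Rightarrow> real" where
  "Psi_minus K \<epsilon> \<gamma> \<Theta>s \<delta> V \<Z> M A Q q h H =
     max_inf (V \<times> \<Z>) (admissible \<gamma> \<Theta>s H) (obj_minus K \<epsilon> \<Theta>s \<delta> M A Q q h H)"

end

theory Submission
  imports Defs
begin

text \<open>
  Fix a signal \<open>(u, v)\<close>, put \<open>\<Theta> = M v\<close>, \<open>\<mu> = A [u; 1]\<close>, \<open>z = [\<mu>; 1]\<close>, and let \<open>\<zeta>\<close> be Gaussian with mean \<open>\<mu>\<close>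
  and covariance \<open>\<Theta>\<close>. The logarithm of the expectation of \<open>exp (h\<^sup>T \<zeta> + \<zeta>\<^sup>T H \<zeta> / 2)\<close> is explicit
  (\<open>nn_integral_std_gaussian_exp_quad\<close>), but its dependence on \<open>\<Theta>\<close> and \<open>\<mu>\<close> is not affine. The function \<open>Phi\<close>
  is an upper bound for it that is affine in \<open>(\<Theta>, z z\<^sup>T)\<close> and convex in \<open>(h, H)\<close>; this is
  \<open>gaussian_exp_quad_le_Phi\<close>. Two facts give the bound. The inverse quadratic form of the exact expression is
  monotone in \<open>\<Theta>\<close>, so \<open>\<Theta>\<close> may be replaced there by \<open>\<Theta>s\<close>. In the log-determinant term, replacing \<open>\<Theta>\<close> by
  \<open>\<Theta>s\<close> costs at most the linear trace term and the Frobenius term of \<open>Phi\<close>, because \<open>ln det\<close> lies below its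
  tangents and \<open>\<Theta>\<close> differs from \<open>\<Theta>s\<close> by a congruence \<open>\<delta>\<close>-close to the identity
  (\<open>ln_det_congruence_perturbation\<close>).

  Chernoff's inequality with parameter \<open>1 / \<alpha>\<close>, applied to \<open>K\<close> independent observations, bounds the probability
  that the sample mean of the quadratic statistic exceeds \<open>F u v + r\<close> by \<open>\<epsilon> / 2\<close> as soon as the objective at
  \<open>(v, [u; 1] [u; 1]\<^sup>T)\<close> is at most \<open>r\<close> for this \<open>\<alpha>\<close>. If only the infimum over \<open>\<alpha>\<close> is at most \<open>r\<close>, this holds
  for every larger level, and continuity of the measure removes the slack (\<open>deviation_prob_le\<close>). The lower deviation is
  the upper deviation for the data \<open>(- Q, - q, - h, - H)\<close>, and \<open>Psi_minus\<close> is \<open>Psi_plus\<close> of these data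
  (\<open>Psi_minus_eq_Psi_plus\<close>). Hence everything is proved for \<open>Psi_plus\<close> only, and a union bound gives the risk.

  Convexity of \<open>Psi_plus\<close> comes from convexity of \<open>Phi\<close> in \<open>(h, H)\<close> (\<open>Phi_convex\<close>): the perspective
  \<open>\<alpha> Phi (h / \<alpha>, H / \<alpha>)\<close> is jointly convex in \<open>(h, H, \<alpha>)\<close>, partial minimization over \<open>\<alpha>\<close> preserves convexity,
  and so does the supremum over \<open>(v, Z)\<close>. The infima are finite because \<open>Phi\<close> dominates a linear function of
  \<open>(h, H)\<close>, whose perspective does not depend on \<open>\<alpha>\<close> (\<open>Phi_ge_linear_part\<close>). The supremum is a maximum because an
  infimum of continuous functions is upper semicontinuous (\<open>max_inf_proper_compact\<close>).

  Matrix analysis rests on the spectral theorem for real symmetric matrices, which yields the positive semidefinite square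
  root and the inequality \<open>ln det A \<le> trace A - n\<close>.
\<close>

section \<open>Spectral theorem for symmetric matrices\<close>

lemma symmetric_mat_inner:
  assumes "symmetric_mat A"
  shows "(A *v x) \<bullet> y = x \<bullet> (A *v y)"
  by (metis assms dot_lmul_matrix symmetric_mat_def transpose_matrix_vector)

text \<open>The first-order condition at a maximum: the linear term dominates for small positive \<open>t\<close>.\<close>

lemma quadratic_form_nonpos_linear_coeff:
  fixes a c :: real
  assumes "\<And>t. 2 * t * a + t\<^sup>2 * c \<le> 0"
  shows "a \<le> 0"
proof (rule ccontr)
  assume "\<not> a \<le> 0"
  then have a: "a > 0" by simp
  define t where "t = a / (\<bar>c\<bar> + 1)"
  have t: "t > 0" using a by (simp add: t_def add_nonneg_pos)
  have "t * \<bar>c\<bar> < t * (\<bar>c\<bar> + 1)" using t by simp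
  also have "\<dots> = a" by (simp add: t_def add_nonneg_pos)
  finally have "- (t * c) < a" by (smt (verit) mult_minus_right t zero_less_mult_pos mult_left_mono abs_ge_minus_self)
  then have "t * (2 * a + t * c) > 0" using t a by (intro mult_pos_pos) auto
  with assms[of t] show False by (simp add: algebra_simps power2_eq_square)
qed

text \<open>A maximizer of the Rayleigh quotient on the unit sphere of an invariant subspace is an eigenvector.\<close>

lemma symmetric_mat_eigenvector:
  fixes A :: "real^'n^'n"
  assumes A: "symmetric_mat A" and S: "subspace S" "\<And>x. x \<in> S \<Longrightarrow> A *v x \<in> S" "\<not> S \<subseteq> {0}"
  obtains v l where "v \<in> S" "norm v = 1" "A *v v = l *\<^sub>R v"
proof -
  let ?C = "S \<inter> sphere 0 1"
  obtain w where w: "w \<in> S" "w \<noteq> 0" using S by auto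
  have "w /\<^sub>R norm w \<in> ?C" using w S(1) by (simp add: subspace_scale)
  moreover have "compact ?C"
    using S(1) by (simp add: closed_subspace compact_Int_closed Int_commute closed_Int_compact)
  moreover have "continuous_on ?C (\<lambda>x. x \<bullet> (A *v x))"
    by (intro continuous_intros linear_continuous_on) (simp add: matrix_vector_mul_bounded_linear)
  ultimately obtain v where v: "v \<in> ?C" "\<And>x. x \<in> ?C \<Longrightarrow> x \<bullet> (A *v x) \<le> v \<bullet> (A *v v)"
    using continuous_attains_sup[of ?C "\<lambda>x. x \<bullet> (A *v x)"] by blast
  define l where "l = v \<bullet> (A *v v)"
  have vv: "v \<bullet> v = 1" using v(1) by (simp add: norm_eq_1)
  have le: "x \<bullet> (A *v x) \<le> l * (x \<bullet> x)" if "x \<in> S" for x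
  proof (cases "x = 0")
    case False
    have "x /\<^sub>R norm x \<in> ?C" using that False S(1) by (simp add: subspace_scale)
    from v(2)[OF this] have "(x \<bullet> (A *v x)) / (norm x)\<^sup>2 \<le> l"
      by (simp add: l_def matrix_vector_mult_scaleR divide_inverse power2_eq_square mult_ac)
    then show ?thesis using False by (simp add: divide_simps power2_norm_eq_inner mult.commute)
  qed simp
  define w where "w = A *v v - l *\<^sub>R v"
  have wS: "w \<in> S" using v(1) S by (simp add: w_def subspace_diff subspace_scale)
  have ww: "w \<bullet> (A *v v) - l * (v \<bullet> w) = w \<bullet> w"
    by (simp add: w_def algebra_simps inner_commute inner_diff_right)
  \<comment> \<open>Moving from the maximizer \<open>v\<close> in the direction \<open>w\<close> of the residual cannot increase the quotient.\<close>
  have "2 * t * (w \<bullet> w) + t\<^sup>2 * (w \<bullet> (A *v w) - l * (w \<bullet> w)) \<le> 0" for t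
  proof -
    have "v + t *\<^sub>R w \<in> S" using v(1) wS S(1) by (simp add: subspace_add subspace_scale)
    from le[OF this] have "l + 2 * t * (w \<bullet> (A *v v)) + t\<^sup>2 * (w \<bullet> (A *v w))
       \<le> l * (1 + 2 * t * (v \<bullet> w) + t\<^sup>2 * (w \<bullet> w))"
      by (simp add: matrix_vector_right_distrib matrix_vector_mult_scaleR inner_add_left inner_add_right
          inner_commute[of w v] l_def[symmetric] vv symmetric_mat_inner[OF A, symmetric, of v w]
          inner_commute[of "A *v v" w] power2_eq_square algebra_simps)
    then show ?thesis unfolding ww[symmetric] by (simp add: algebra_simps)
  qed
  then have "w \<bullet> w \<le> 0" by (rule quadratic_form_nonpos_linear_coeff)
  then have "w = 0" by (simp add: inner_gt_zero_iff linorder_not_less[symmetric])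
  then show ?thesis using that[of v l] v(1) by (simp add: w_def)
qed

text \<open>The orthogonal complement of a set of eigenvectors is invariant, hence contains a further eigenvector unless it is
  trivial. So an orthonormal set of eigenvectors of maximal cardinality is a basis.\<close>

lemma symmetric_mat_orthonormal_eigenbasis:
  fixes A :: "real^'n^'n"
  assumes A: "symmetric_mat A"
  obtains e :: "'n \<Rightarrow> real^'n" and d
  where "\<And>i j. e i \<bullet> e j = (if i = j then 1 else 0)" "\<And>i. A *v e i = d i *\<^sub>R e i"
proof -
  define P where "P B \<longleftrightarrow> pairwise orthogonal B \<and> (\<forall>v\<in>B. norm v = 1 \<and> (\<exists>l. A *v v = l *\<^sub>R v))" for B
  have ind: "independent B" if "P B" for B
    using that unfolding P_def by (intro pairwise_orthogonal_independent) auto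
  have card: "finite B \<and> card B \<le> CARD('n)" if "P B" for B
    using independent_bound[OF ind[OF that]] by simp
  have "P {}" by (simp add: P_def)
  then obtain B where B: "P B" "\<And>C. P C \<Longrightarrow> card C \<le> card B"
    using ex_has_greatest_nat[of P "{}" card "Suc CARD('n)"] card by (meson le_imp_less_Suc)
  let ?S = "{x. \<forall>v\<in>B. orthogonal v x}"
  have "?S \<subseteq> {0}"
  proof (rule ccontr)
    assume ne: "\<not> ?S \<subseteq> {0}"
    have sub: "subspace ?S" by (simp add: subspace_def orthogonal_clauses)
    have inv: "A *v x \<in> ?S" if "x \<in> ?S" for x
    proof -
      have "v \<bullet> (A *v x) = 0" if "v \<in> B" for v
      proof -
        obtain l where "A *v v = l *\<^sub>R v" using \<open>v \<in> B\<close> B(1) by (auto simp: P_def)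
        then have "v \<bullet> (A *v x) = l * (v \<bullet> x)"
          by (metis symmetric_mat_inner[OF A] inner_scaleR_left)
        then show ?thesis using \<open>x \<in> ?S\<close> that by (auto simp: orthogonal_def)
      qed
      then show ?thesis by (auto simp: orthogonal_def)
    qed
    obtain v l where v: "v \<in> ?S" "norm v = 1" "A *v v = l *\<^sub>R v"
      using symmetric_mat_eigenvector[OF A sub inv ne] by blast
    have "P (insert v B)" using B(1) v
      by (auto simp: P_def pairwise_insert orthogonal_commute)
    moreover have "v \<notin> B" using v by (auto simp: orthogonal_def)
    ultimately show False using B(2)[of "insert v B"] card[OF B(1)] by simp
  qed
  have "card B = CARD('n)"
  proof -
    have "span B = UNIV"
    proof (rule ccontr)
      assume "span B \<noteq> UNIV"
      then obtain x where "x \<noteq> 0" "\<forall>y\<in>span B. orthogonal x y"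
        using span_not_UNIV_orthogonal[of B] by (auto simp: orthogonal_def)
      then have "x \<in> ?S" by (auto simp: orthogonal_commute span_base)
      with \<open>?S \<subseteq> {0}\<close> \<open>x \<noteq> 0\<close> show False by auto
    qed
    then have "dim (UNIV::(real^'n) set) = card B"
      by (metis ind[OF B(1)] dim_span dim_eq_card_independent)
    then show ?thesis by simp
  qed
  then obtain e where e: "bij_betw e (UNIV::'n set) B"
    using card[OF B(1)] finite_same_card_bij[of "UNIV::'n set" B] by auto
  have eB: "e i \<in> B" for i using e by (auto simp: bij_betw_def)
  have "\<forall>i. \<exists>l. A *v e i = l *\<^sub>R e i" using eB B(1) by (auto simp: P_def)
  then obtain d where d: "\<And>i. A *v e i = d i *\<^sub>R e i" by metis
  have "e i \<bullet> e j = (if i = j then 1 else 0)" for i j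
  proof (cases "i = j")
    case True
    then show ?thesis using eB[of i] B(1) by (auto simp: P_def norm_eq_1)
  next
    case False
    then have "e i \<noteq> e j" using e by (auto simp: bij_betw_def inj_on_def)
    then show ?thesis using False eB[of i] eB[of j] B(1) by (auto simp: P_def pairwise_def orthogonal_def)
  qed
  then show ?thesis using that d by blast
qed

definition diag_mat :: "('n \<Rightarrow> real) \<Rightarrow> real^'n^'n" where
  "diag_mat d = (\<chi> i j. if i = j then d i else 0)"

lemma diag_mat_mult_vec: "diag_mat d *v x = (\<chi> i. d i * x $ i)"
  by (simp add: diag_mat_def matrix_vector_mult_def vec_eq_iff if_distrib if_distribR sum.delta' cong: if_cong)

lemma transpose_diag_mat: "transpose (diag_mat d) = diag_mat d"
  by (auto simp: diag_mat_def transpose_def vec_eq_iff)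

lemma det_diag_mat: "det (diag_mat d) = (\<Prod>i\<in>UNIV. d i)"
  by (subst det_diagonal) (auto simp: diag_mat_def)

lemma trace_diag_mat: "trace (diag_mat d) = (\<Sum>i\<in>UNIV. d i)"
  by (simp add: trace_def diag_mat_def)

lemma diag_mat_mult: "diag_mat d ** diag_mat e = diag_mat (\<lambda>i. d i * e i)"
proof -
  have "(\<Sum>k\<in>UNIV. (if i = k then d i else 0) * (if k = j then e k else 0)) =
    (\<Sum>k\<in>UNIV. if k = i then (if i = j then d i * e i else 0) else 0)" for i j
    by (intro sum.cong) auto
  then show ?thesis by (simp add: diag_mat_def matrix_matrix_mult_def vec_eq_iff)
qed

lemma mat_1_diag: "mat 1 = diag_mat (\<lambda>_. 1)"
  by (simp add: mat_def diag_mat_def)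

lemma diag_mat_diff: "diag_mat d - diag_mat e = diag_mat (\<lambda>i. d i - e i)"
  by (auto simp: diag_mat_def vec_eq_iff)

lemma orthogonal_matrix_mult:
  fixes R :: "real^'n^'n"
  assumes "orthogonal_matrix R"
  shows "transpose R ** R = mat 1" "R ** transpose R = mat 1"
  using assms by (auto simp: orthogonal_matrix_def)

theorem symmetric_mat_diagonalization:
  fixes A :: "real^'n^'n"
  assumes A: "symmetric_mat A"
  obtains R d where "orthogonal_matrix R" "A = R ** diag_mat d ** transpose R"
proof -
  obtain e :: "'n \<Rightarrow> real^'n" and d
  where e: "\<And>i j. e i \<bullet> e j = (if i = j then 1 else 0)" and d: "\<And>i. A *v e i = d i *\<^sub>R e i"
    using symmetric_mat_orthonormal_eigenbasis[OF A] by blast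
  define R :: "real^'n^'n" where "R = (\<chi> i j. e j $ i)"
  have R: "orthogonal_matrix R"
    unfolding orthogonal_matrix using e
    by (simp add: R_def matrix_matrix_mult_def transpose_def mat_def vec_eq_iff inner_vec_def)
  have "A ** R = R ** diag_mat d"
  proof -
    have "(A ** R) $ i $ j = (R ** diag_mat d) $ i $ j" for i j
    proof -
      have "(A ** R) $ i $ j = (A *v e j) $ i"
        by (simp add: R_def matrix_matrix_mult_def matrix_vector_mult_def)
      also have "\<dots> = d j * e j $ i" by (simp add: d)
      also have "\<dots> = (R ** diag_mat d) $ i $ j"
        by (simp add: R_def matrix_matrix_mult_def diag_mat_def if_distrib if_distribR sum.delta' cong: if_cong)
      finally show ?thesis .
    qed
    then show ?thesis by (simp add: vec_eq_iff)
  qed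
  then have "A = R ** diag_mat d ** transpose R"
    using orthogonal_matrix_mult[OF R] by (metis matrix_mul_assoc matrix_mul_rid)
  with R that show ?thesis by blast
qed

section \<open>Matrix algebra\<close>

lemma matrix_mul_add_left: "(A + B) ** C = A ** C + B ** (C :: real^'p^'n)"
  by (simp add: matrix_eq matrix_vector_mul_assoc[symmetric] matrix_vector_mult_add_rdistrib)

lemma matrix_mul_diff_left: "(A - B) ** C = A ** C - B ** (C :: real^'p^'n)"
  by (simp add: matrix_eq matrix_vector_mul_assoc[symmetric] matrix_vector_mult_diff_rdistrib)

lemma matrix_mul_diff_right: "C ** (A - B) = C ** A - C ** (B :: real^'p^'n)"
  by (simp add: matrix_eq matrix_vector_mul_assoc[symmetric] matrix_vector_mult_diff_rdistrib
      matrix_vector_mult_diff_distrib)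

lemma scaleR_matrix_vector: "(c *\<^sub>R A) *v x = c *\<^sub>R ((A :: real^'n^'m) *v x)"
  by (simp add: matrix_vector_mult_def vec_eq_iff sum_distrib_left mult.assoc)

lemma matrix_mul_scaleR_left: "(c *\<^sub>R A) ** B = c *\<^sub>R (A ** (B :: real^'p^'n))"
  by (simp add: matrix_eq matrix_vector_mul_assoc[symmetric] scaleR_matrix_vector)

lemma matrix_mul_scaleR_right: "A ** (c *\<^sub>R B) = c *\<^sub>R (A ** (B :: real^'p^'n))"
  by (simp add: matrix_eq matrix_vector_mul_assoc[symmetric] scaleR_matrix_vector matrix_vector_mult_scaleR)

lemma trace_scaleR: "trace (c *\<^sub>R A) = c * trace (A :: real^'n^'n)"
  by (simp add: trace_def sum_distrib_left)

lemma matrix_vector_mult_uminus: "(- A) *v x = - ((A :: real^'n^'m) *v x)"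
  by (simp add: matrix_vector_mult_def vec_eq_iff sum_negf)

lemma trace_uminus: "trace (- A) = - trace (A :: real^'n^'n)"
  by (simp add: trace_def sum_negf)

lemma transpose_add: "transpose (A + B) = transpose A + transpose (B :: real^'n^'m)"
  by (simp add: transpose_def vec_eq_iff)

lemma transpose_diff: "transpose (A - B) = transpose A - transpose (B :: real^'n^'m)"
  by (simp add: transpose_def vec_eq_iff)

lemma transpose_uminus: "transpose (- A) = - transpose (A :: real^'n^'m)"
  by (simp add: transpose_def vec_eq_iff)

lemma symmetric_mat_scaleR: "symmetric_mat A \<Longrightarrow> symmetric_mat (c *\<^sub>R A)"
  by (simp add: symmetric_mat_def transpose_scalar)

lemma symmetric_mat_add: "symmetric_mat A \<Longrightarrow> symmetric_mat B \<Longrightarrow> symmetric_mat (A + B)"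
  by (simp add: symmetric_mat_def transpose_add)

lemma symmetric_mat_diff: "symmetric_mat A \<Longrightarrow> symmetric_mat B \<Longrightarrow> symmetric_mat (A - B)"
  by (simp add: symmetric_mat_def transpose_diff)

lemma symmetric_mat_uminus: "symmetric_mat A \<Longrightarrow> symmetric_mat (- A)"
  by (simp add: symmetric_mat_def transpose_uminus)

lemma symmetric_mat_congruence: "symmetric_mat A \<Longrightarrow> symmetric_mat (X ** A ** transpose X)"
  by (simp add: symmetric_mat_def matrix_transpose_mul matrix_mul_assoc)

lemma symmetric_mat_1 [simp]: "symmetric_mat (mat 1)"
  by (simp add: symmetric_mat_def)

lemma inner_congruence: "x \<bullet> ((X ** A ** transpose X) *v x) = (transpose X *v x) \<bullet> (A *v (transpose X *v x))"
  for x :: "real^'m" and X :: "real^'n^'m"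
  by (simp add: matrix_vector_mul_assoc[symmetric] dot_lmul_matrix)

lemma psd_congruence: "psd A \<Longrightarrow> psd (X ** A ** transpose X)"
  by (simp only: psd_def symmetric_mat_congruence inner_congruence simp_thms)

lemma posdef_psd: "posdef A \<Longrightarrow> psd A"
  unfolding posdef_def psd_def by (metis inner_zero_left less_eq_real_def)

lemma posdef_sym: "posdef A \<Longrightarrow> symmetric_mat A" by (simp add: posdef_def)
lemma psd_sym: "psd A \<Longrightarrow> symmetric_mat A" by (simp add: psd_def)

lemma inner_diag_mat: "x \<bullet> (diag_mat d *v x) = (\<Sum>i\<in>UNIV. d i * (x $ i)\<^sup>2)"
  by (simp add: diag_mat_mult_vec inner_vec_def power2_eq_square mult_ac)

text \<open>The diagonal entries are values of the quadratic form, which makes their signs visible.\<close>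

lemma inner_orthogonal_conj_axis:
  fixes R :: "real^'n^'n"
  assumes "orthogonal_matrix R"
  shows "(R *v axis i 1) \<bullet> ((R ** diag_mat d ** transpose R) *v (R *v axis i 1)) = d i"
proof -
  have "transpose R *v (R *v axis i 1) = axis i 1"
    by (simp add: orthogonal_matrix_mult[OF assms] matrix_vector_mul_assoc del: transpose_matrix_vector)
  moreover have "(\<Sum>k\<in>UNIV. d k * (axis i 1 $ k)\<^sup>2) = (\<Sum>k\<in>UNIV. if k = i then d k else 0)"
    by (intro sum.cong) (auto simp: axis_def)
  ultimately show ?thesis by (simp only: inner_congruence inner_diag_mat) simp
qed

lemma orthogonal_matrix_mult_axis_nonzero:
  fixes R :: "real^'n^'n"
  assumes "orthogonal_matrix R"
  shows "R *v axis i 1 \<noteq> 0"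
proof
  assume "R *v axis i 1 = 0"
  then have "transpose R *v (R *v axis i 1) = 0" by simp
  then show False
    by (simp add: orthogonal_matrix_mult[OF assms] matrix_vector_mul_assoc del: transpose_matrix_vector)
qed

section \<open>Square roots and inverses of positive matrices\<close>

lemma psd_diagonalization:
  fixes A :: "real^'n^'n"
  assumes A: "psd A"
  obtains R d where "orthogonal_matrix R" "A = R ** diag_mat d ** transpose R" "\<And>i. 0 \<le> d i"
proof -
  obtain R d where R: "orthogonal_matrix R" "A = R ** diag_mat d ** transpose R"
    using symmetric_mat_diagonalization[OF psd_sym[OF A]] .
  have "0 \<le> d i" for i
    using A inner_orthogonal_conj_axis[OF R(1), of i d] by (metis R(2) psd_def)
  with R that show ?thesis by blast
qed

lemma posdef_diagonalization:
  fixes A :: "real^'n^'n"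
  assumes A: "posdef A"
  obtains R d where "orthogonal_matrix R" "A = R ** diag_mat d ** transpose R" "\<And>i. 0 < d i"
proof -
  obtain R d where R: "orthogonal_matrix R" "A = R ** diag_mat d ** transpose R"
    using symmetric_mat_diagonalization[OF posdef_sym[OF A]] .
  have "0 < d i" for i
    using A inner_orthogonal_conj_axis[OF R(1), of i d] orthogonal_matrix_mult_axis_nonzero[OF R(1), of i]
    by (metis R(2) posdef_def)
  with R that show ?thesis by blast
qed

lemma det_orthogonal_conj:
  fixes R :: "real^'n^'n"
  assumes "orthogonal_matrix R"
  shows "det (R ** B ** transpose R) = det B"
proof -
  have "det R * det R = 1"
    using arg_cong[OF orthogonal_matrix_mult(2)[OF assms], of det] by (simp add: det_mul)
  then show ?thesis by (simp add: det_mul)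
qed

lemma trace_orthogonal_conj:
  fixes R :: "real^'n^'n"
  assumes "orthogonal_matrix R"
  shows "trace (R ** B ** transpose R) = trace B"
  by (metis assms matrix_mul_assoc matrix_mul_lid orthogonal_matrix_mult(1) trace_mul_sym)

lemma psd_quad_eq_0:
  fixes A :: "real^'n^'n"
  assumes A: "psd A" and x: "x \<bullet> (A *v x) = 0"
  shows "A *v x = 0"
proof -
  obtain Q c where Q: "orthogonal_matrix Q" "A = Q ** diag_mat c ** transpose Q" "\<And>i. 0 \<le> c i"
    using psd_diagonalization[OF A] by blast
  define y where "y = transpose Q *v x"
  have "(\<Sum>i\<in>UNIV. c i * (y $ i)\<^sup>2) = 0"
    using x unfolding Q(2) inner_congruence inner_diag_mat y_def .
  then have "\<forall>i. c i * (y $ i)\<^sup>2 = 0"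
    by (subst (asm) sum_nonneg_eq_0_iff) (auto simp: Q(3))
  then have "diag_mat c *v y = 0" by (auto simp: diag_mat_mult_vec vec_eq_iff)
  then show ?thesis by (simp add: Q(2) y_def matrix_vector_mul_assoc[symmetric])
qed

text \<open>If \<open>x\<close> is an eigenvector of \<open>R - S\<close> with eigenvalue \<open>c\<close>, the identity \<open>R (R - S) + (R - S) S = R\<^sup>2 - S\<^sup>2 = 0\<close>
  gives \<open>c (x \<bullet> R x + x \<bullet> S x) = 0\<close>. For \<open>c \<noteq> 0\<close> both forms vanish at \<open>x\<close>, so \<open>R x = S x = 0\<close>, contradicting
  \<open>(R - S) x = c x\<close>.\<close>

lemma psd_sqrt_unique:
  fixes R S :: "real^'n^'n"
  assumes R: "psd R" and S: "psd S" and eq: "R ** R = S ** S"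
  shows "R = S"
proof -
  have sym: "symmetric_mat (R - S)" using R S by (simp add: psd_sym symmetric_mat_diff)
  obtain Q c where Q: "orthogonal_matrix Q" "R - S = Q ** diag_mat c ** transpose Q"
    using symmetric_mat_diagonalization[OF sym] .
  have "c i = 0" for i
  proof (rule ccontr)
    assume ci: "c i \<noteq> 0"
    define x where "x = Q *v axis i 1"
    have x0: "x \<noteq> 0" using orthogonal_matrix_mult_axis_nonzero[OF Q(1)] by (simp add: x_def)
    have "(R - S) *v x = Q *v (diag_mat c *v (transpose Q *v (Q *v axis i 1)))"
      by (simp only: Q(2) x_def matrix_vector_mul_assoc matrix_mul_assoc)
    also have "transpose Q *v (Q *v axis i 1) = axis i 1"
      by (simp add: orthogonal_matrix_mult[OF Q(1)] matrix_vector_mul_assoc del: transpose_matrix_vector)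
    also have "diag_mat c *v axis i 1 = c i *\<^sub>R axis i 1"
      by (simp add: diag_mat_mult_vec vec_eq_iff axis_def)
    finally have ev: "(R - S) *v x = c i *\<^sub>R x" by (simp add: x_def matrix_vector_mult_scaleR)
    have "R ** (R - S) + (R - S) ** S = 0"
      by (simp add: matrix_mul_diff_left matrix_mul_diff_right eq)
    then have "x \<bullet> (R *v ((R - S) *v x)) + x \<bullet> ((R - S) *v (S *v x)) = 0"
      by (metis inner_add_right inner_zero_right matrix_vector_mul_assoc matrix_vector_mult_0 matrix_vector_mult_add_rdistrib)
    moreover have "x \<bullet> ((R - S) *v (S *v x)) = c i * (x \<bullet> (S *v x))"
      using symmetric_mat_inner[OF sym, of x "S *v x"] by (simp add: ev)
    moreover have "x \<bullet> (R *v ((R - S) *v x)) = c i * (x \<bullet> (R *v x))"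
      by (simp only: ev matrix_vector_mult_scaleR inner_scaleR_right)
    ultimately have "c i * (x \<bullet> (R *v x) + x \<bullet> (S *v x)) = 0"
      by (simp only: distrib_left)
    then have "x \<bullet> (R *v x) + x \<bullet> (S *v x) = 0" using ci by simp
    then have "x \<bullet> (R *v x) = 0" "x \<bullet> (S *v x) = 0" using R S unfolding psd_def by (smt (verit))+
    then have "R *v x = 0" "S *v x = 0" using psd_quad_eq_0 R S by auto
    then have "c i *\<^sub>R x = 0" by (metis ev matrix_vector_mult_diff_rdistrib diff_zero)
    with ci x0 show False by simp
  qed
  then have "diag_mat c = 0" by (simp add: diag_mat_def vec_eq_iff)
  then have "R - S = 0" by (simp add: Q(2) matrix_eq matrix_vector_mul_assoc[symmetric])
  then show ?thesis by simp
qed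

lemma psd_sqrt_ex:
  fixes A :: "real^'n^'n"
  assumes A: "psd A"
  obtains R where "psd R" "R ** R = A"
proof -
  obtain Q d where Q: "orthogonal_matrix Q" "A = Q ** diag_mat d ** transpose Q" "\<And>i. 0 \<le> d i"
    using psd_diagonalization[OF A] by blast
  define R where "R = Q ** diag_mat (\<lambda>i. sqrt (d i)) ** transpose Q"
  have "psd R" unfolding R_def
    by (rule psd_congruence) (auto simp: psd_def symmetric_mat_def transpose_diag_mat inner_diag_mat Q(3) intro!: sum_nonneg)
  moreover have "R ** R = Q ** (diag_mat (\<lambda>i. sqrt (d i)) ** (transpose Q ** Q) ** diag_mat (\<lambda>i. sqrt (d i))) ** transpose Q"
    by (simp only: R_def matrix_mul_assoc)
  then have "R ** R = A"
    by (simp add: orthogonal_matrix_mult[OF Q(1)] Q(2,3) diag_mat_mult)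
  ultimately show ?thesis using that by blast
qed

lemma psd_sqrt:
  fixes A :: "real^'n^'n"
  assumes A: "psd A"
  shows "psd (psd_sqrt A)" "psd_sqrt A ** psd_sqrt A = A"
proof -
  have "\<exists>!R. psd R \<and> R ** R = A"
    using psd_sqrt_ex[OF A] psd_sqrt_unique by metis
  then have "psd (psd_sqrt A) \<and> psd_sqrt A ** psd_sqrt A = A"
    unfolding psd_sqrt_def by (rule theI')
  then show "psd (psd_sqrt A)" "psd_sqrt A ** psd_sqrt A = A" by auto
qed

lemma posdef_invertible:
  fixes A :: "real^'n^'n"
  assumes "posdef A"
  shows "invertible A"
proof -
  have "\<forall>x. A *v x = 0 \<longrightarrow> x = 0" using assms unfolding posdef_def by (metis inner_zero_right less_irrefl)
  then show ?thesis by (metis invertible_left_inverse matrix_left_invertible_ker)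
qed

lemma matrix_inv_mult:
  fixes A :: "real^'n^'n"
  assumes "invertible A"
  shows "A ** matrix_inv A = mat 1" "matrix_inv A ** A = mat 1"
proof -
  have "A ** matrix_inv A = mat 1 \<and> matrix_inv A ** A = mat 1"
    unfolding matrix_inv_def using assms unfolding invertible_def by (rule someI_ex)
  then show "A ** matrix_inv A = mat 1" "matrix_inv A ** A = mat 1" by auto
qed

lemma matrix_inv_eqI:
  fixes A B :: "real^'n^'n"
  assumes "A ** B = mat 1"
  shows "matrix_inv A = B"
proof -
  have "invertible A" using assms invertible_right_inverse by blast
  then have "matrix_inv A ** (A ** B) = B"
    by (metis matrix_inv_mult(2) matrix_mul_assoc matrix_mul_lid)
  then show ?thesis by (simp add: assms)
qed

lemma matrix_inv_mult_vec:
  fixes A :: "real^'n^'n"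
  assumes "invertible A"
  shows "A *v (matrix_inv A *v x) = x" "matrix_inv A *v (A *v x) = x"
  using matrix_inv_mult[OF assms] by (simp_all add: matrix_vector_mul_assoc)

lemma symmetric_mat_inv:
  fixes A :: "real^'n^'n"
  assumes "symmetric_mat A" "invertible A"
  shows "symmetric_mat (matrix_inv A)"
proof -
  have "transpose (matrix_inv A ** A) = mat 1" by (simp add: matrix_inv_mult assms)
  then have "A ** transpose (matrix_inv A) = mat 1"
    using assms by (simp add: matrix_transpose_mul symmetric_mat_def)
  from matrix_inv_eqI[OF this] show ?thesis unfolding symmetric_mat_def by (rule sym)
qed

lemma posdef_matrix_inv:
  fixes A :: "real^'n^'n"
  assumes A: "posdef A"
  shows "posdef (matrix_inv A)"
proof -
  note inv = matrix_inv_mult_vec[OF posdef_invertible[OF A]]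
  have "0 < x \<bullet> (matrix_inv A *v x)" if "x \<noteq> 0" for x
  proof -
    have "matrix_inv A *v x \<noteq> 0" using inv(1)[of x] that by auto
    then have "0 < (matrix_inv A *v x) \<bullet> (A *v (matrix_inv A *v x))" using A by (simp add: posdef_def)
    then show ?thesis by (simp add: inv inner_commute)
  qed
  then show ?thesis using symmetric_mat_inv[OF posdef_sym[OF A] posdef_invertible[OF A]]
    by (simp add: posdef_def)
qed

lemma posdef_psd_sqrt:
  fixes A :: "real^'n^'n"
  assumes A: "posdef A"
  shows "posdef (psd_sqrt A)"
proof -
  let ?R = "psd_sqrt A"
  have R: "psd ?R" "?R ** ?R = A" using psd_sqrt[OF posdef_psd[OF A]] by auto
  obtain Q d where Q: "orthogonal_matrix Q" "?R = Q ** diag_mat d ** transpose Q" "\<And>i. 0 \<le> d i"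
    using psd_diagonalization[OF R(1)] by blast
  have "det ?R * det ?R = det A" by (metis R(2) det_mul)
  moreover have "det A \<noteq> 0" using posdef_invertible[OF A] invertible_det_nz by blast
  ultimately have "(\<Prod>i\<in>UNIV. d i) \<noteq> 0" using Q by (metis det_diag_mat det_orthogonal_conj mult_zero_left)
  then have d: "0 < d i" for i using Q(3)[of i] by (auto simp: less_le)
  have "0 < x \<bullet> (?R *v x)" if "x \<noteq> 0" for x
  proof -
    define y where "y = transpose Q *v x"
    have "Q *v y = x" unfolding y_def
      by (simp add: orthogonal_matrix_mult[OF Q(1)] matrix_vector_mul_assoc del: transpose_matrix_vector)
    then have "y \<noteq> 0" using that by auto
    then obtain i where "y $ i \<noteq> 0" by (auto simp: vec_eq_iff)
    then have "0 < (\<Sum>i\<in>UNIV. d i * (y $ i)\<^sup>2)"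
      using d by (intro sum_pos2[where i=i]) (auto simp: less_imp_le)
    then show ?thesis unfolding Q(2) inner_congruence inner_diag_mat y_def[symmetric] .
  qed
  then show ?thesis using R(1) by (simp add: posdef_def psd_def)
qed

section \<open>Log-determinant and inverse quadratic forms\<close>

text \<open>Apply \<open>ln t \<le> t - 1\<close> to each eigenvalue.\<close>

lemma posdef_ln_det_le_trace:
  fixes A :: "real^'n^'n"
  assumes A: "posdef A"
  shows "0 < det A" "ln (det A) \<le> trace A - real CARD('n)"
proof -
  obtain R d where R: "orthogonal_matrix R" "A = R ** diag_mat d ** transpose R" and d: "\<And>i. 0 < d i"
    using posdef_diagonalization[OF A] by blast
  have det: "det A = (\<Prod>i\<in>UNIV. d i)" by (simp add: R det_orthogonal_conj det_diag_mat)
  then show "0 < det A" by (simp add: d prod_pos)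
  have "ln (det A) = (\<Sum>i\<in>UNIV. ln (d i))" unfolding det by (rule ln_prod) (auto, metis d less_irrefl)
  also have "\<dots> \<le> (\<Sum>i\<in>UNIV. d i - 1)" by (intro sum_mono ln_le_minus_one d)
  also have "\<dots> = trace A - real CARD('n)"
    by (simp add: R trace_orthogonal_conj trace_diag_mat sum_subtractf)
  finally show "ln (det A) \<le> trace A - real CARD('n)" .
qed

lemma matrix_inv_eq_sqrt_inv_square:
  fixes A :: "real^'n^'n"
  assumes A: "posdef A"
  shows "matrix_inv A = matrix_inv (psd_sqrt A) ** matrix_inv (psd_sqrt A)"
proof (rule matrix_inv_eqI)
  define L where "L = psd_sqrt A"
  have L: "L ** L = A" using psd_sqrt(2)[OF posdef_psd[OF A]] by (simp add: L_def)
  note inv = matrix_inv_mult[OF posdef_invertible[OF posdef_psd_sqrt[OF A]], folded L_def]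
  have "A ** (matrix_inv L ** matrix_inv L) = L ** (L ** matrix_inv L) ** matrix_inv L"
    by (simp add: L[symmetric] matrix_mul_assoc)
  then show "A ** (matrix_inv (psd_sqrt A) ** matrix_inv (psd_sqrt A)) = mat 1"
    by (simp add: inv L_def[symmetric])
qed

text \<open>The concave function \<open>ln det\<close> lies below its tangent at \<open>P\<close>. The congruence by \<open>P\<^sup>-\<^sup>1\<^sup>/\<^sup>2\<close> moves \<open>P\<close> to the identity,
  where the claim is the inequality between log-determinant and trace.\<close>

theorem ln_det_le_linearization:
  fixes P R :: "real^'n^'n"
  assumes P: "posdef P" and R: "posdef R"
  shows "ln (det R) \<le> ln (det P) + trace (matrix_inv P ** (R - P))"
proof -
  define L where "L = psd_sqrt P"
  have L: "posdef L" unfolding L_def by (rule posdef_psd_sqrt[OF P])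
  let ?J = "matrix_inv L"
  have J: "posdef ?J" by (rule posdef_matrix_inv[OF L])
  have JT: "transpose ?J = ?J" using posdef_sym[OF J] by (simp add: symmetric_mat_def)
  have PJ: "matrix_inv P = ?J ** ?J" unfolding L_def by (rule matrix_inv_eq_sqrt_inv_square[OF P])
  \<comment> \<open>The congruence taking \<open>P\<close> to the identity.\<close>
  define Y where "Y = ?J ** R ** transpose ?J"
  have "posdef Y" unfolding posdef_def
  proof (intro conjI allI impI)
    show "symmetric_mat Y" unfolding Y_def by (rule symmetric_mat_congruence[OF posdef_sym[OF R]])
    fix x :: "real^'n" assume "x \<noteq> 0"
    then have "?J *v x \<noteq> 0" using matrix_inv_mult_vec(1)[OF posdef_invertible[OF L], of x] by auto
    then have "0 < (?J *v x) \<bullet> (R *v (?J *v x))" using R by (simp add: posdef_def)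
    then show "0 < x \<bullet> (Y *v x)" using inner_congruence[of x ?J R, unfolded JT] by (simp add: Y_def JT)
  qed
  note Y = posdef_ln_det_le_trace[OF this]
  have detP: "0 < det P" and detR: "0 < det R" using posdef_ln_det_le_trace P R by auto
  have "det ?J * det ?J = 1 / det P"
    using arg_cong[OF matrix_inv_mult(1)[OF posdef_invertible[OF P]], of det] detP
    by (simp add: PJ det_mul field_simps)
  moreover have "det Y = (det ?J * det ?J) * det R" by (simp add: Y_def det_mul)
  ultimately have "det Y = det R / det P" by simp
  moreover have "trace Y = trace (matrix_inv P ** R)"
    by (simp add: Y_def JT PJ) (metis matrix_mul_assoc trace_mul_sym)
  ultimately have "ln (det R) - ln (det P) \<le> trace (matrix_inv P ** R) - real CARD('n)"
    using Y detP detR by (simp add: ln_div)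
  moreover have "trace (matrix_inv P ** (R - P)) = trace (matrix_inv P ** R) - real CARD('n)"
    by (simp add: matrix_mul_diff_right trace_sub matrix_inv_mult posdef_invertible P trace_I)
  ultimately show ?thesis by simp
qed

lemma posdef_convex_combination:
  fixes P R :: "real^'n^'n"
  assumes "posdef P" "posdef R" "0 \<le> u" "0 \<le> v" "u + v = 1"
  shows "posdef (u *\<^sub>R P + v *\<^sub>R R)"
proof -
  have "0 < u * (x \<bullet> (P *v x)) + v * (x \<bullet> (R *v x))" if "x \<noteq> 0" for x
  proof (cases "u = 0")
    case True
    then show ?thesis using assms that by (simp add: posdef_def)
  next
    case False
    then have "0 < u * (x \<bullet> (P *v x))" using assms that by (simp add: posdef_def)
    moreover have "0 \<le> v * (x \<bullet> (R *v x))" using assms that by (simp add: posdef_def less_imp_le)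
    ultimately show ?thesis by simp
  qed
  then show ?thesis using assms
    by (simp add: posdef_def symmetric_mat_add symmetric_mat_scaleR matrix_vector_mult_add_rdistrib
        scaleR_matrix_vector inner_add_right)
qed

text \<open>Average the tangent inequality at the convex combination.\<close>

lemma ln_det_concave:
  fixes P R :: "real^'n^'n"
  assumes P: "posdef P" and R: "posdef R" and uv: "0 \<le> u" "0 \<le> v" "u + v = 1"
  shows "u * ln (det P) + v * ln (det R) \<le> ln (det (u *\<^sub>R P + v *\<^sub>R R))"
proof -
  define C where "C = u *\<^sub>R P + v *\<^sub>R R"
  have C: "posdef C" unfolding C_def by (rule posdef_convex_combination[OF assms])
  have "u * ln (det P) + v * ln (det R) \<le>
    u * (ln (det C) + trace (matrix_inv C ** (P - C))) + v * (ln (det C) + trace (matrix_inv C ** (R - C)))"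
    by (intro add_mono mult_left_mono ln_det_le_linearization C P R uv)
  also have "\<dots> = (u + v) * ln (det C) + trace (matrix_inv C ** (u *\<^sub>R (P - C) + v *\<^sub>R (R - C)))"
    by (simp add: matrix_add_ldistrib matrix_mul_scaleR_right trace_add trace_scaleR ring_distribs)
  also have "u *\<^sub>R (P - C) + v *\<^sub>R (R - C) = C - (u + v) *\<^sub>R C" by (simp add: C_def algebra_simps)
  also have "(u + v) * ln (det C) + trace (matrix_inv C ** (C - (u + v) *\<^sub>R C)) = ln (det C)"
    using trace_0 by (simp add: uv mat_def trace_def matrix_matrix_mult_def)
  finally show ?thesis by (simp add: C_def)
qed

text \<open>Together with \<open>posdef_inv_quad_eq\<close> this says that \<open>b \<bullet> P\<^sup>-\<^sup>1 b\<close> is the maximum over \<open>y\<close> of \<open>2 y \<bullet> b - y \<bullet> P y\<close>,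
  a family of functions linear in \<open>(b, P)\<close>. Both the joint convexity of the form and its monotonicity in \<open>P\<close> follow from
  this variational formula.\<close>

lemma posdef_inv_quad_ge:
  fixes P :: "real^'n^'n"
  assumes P: "posdef P"
  shows "2 * (y \<bullet> b) - y \<bullet> (P *v y) \<le> b \<bullet> (matrix_inv P *v b)"
proof -
  define z where "z = matrix_inv P *v b"
  have Pz: "P *v z = b" by (simp add: z_def matrix_inv_mult_vec posdef_invertible P)
  have "0 \<le> (y - z) \<bullet> (P *v (y - z))" using posdef_psd[OF P] by (simp add: psd_def)
  also have "\<dots> = y \<bullet> (P *v y) - 2 * (y \<bullet> b) + b \<bullet> z"
    using symmetric_mat_inner[OF posdef_sym[OF P], of z y]
    by (simp add: matrix_vector_mult_diff_distrib inner_diff_left inner_diff_right Pz inner_commute)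
  finally show ?thesis by (simp add: z_def)
qed

lemma posdef_inv_quad_eq:
  fixes P :: "real^'n^'n"
  assumes P: "posdef P"
  shows "b \<bullet> (matrix_inv P *v b)
    = 2 * ((matrix_inv P *v b) \<bullet> b) - (matrix_inv P *v b) \<bullet> (P *v (matrix_inv P *v b))"
  by (simp add: matrix_inv_mult_vec posdef_invertible P inner_commute)

lemma posdef_inv_quad_convex:
  fixes P R :: "real^'n^'n"
  assumes P: "posdef P" and R: "posdef R" and uv: "0 \<le> u" "0 \<le> v" "u + v = 1"
  shows "(u *\<^sub>R a + v *\<^sub>R b) \<bullet> (matrix_inv (u *\<^sub>R P + v *\<^sub>R R) *v (u *\<^sub>R a + v *\<^sub>R b))
    \<le> u * (a \<bullet> (matrix_inv P *v a)) + v * (b \<bullet> (matrix_inv R *v b))"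
proof -
  let ?C = "u *\<^sub>R P + v *\<^sub>R R"
  let ?c = "u *\<^sub>R a + v *\<^sub>R b"
  define y where "y = matrix_inv ?C *v ?c"
  have "?c \<bullet> (matrix_inv ?C *v ?c) = 2 * (y \<bullet> ?c) - y \<bullet> (?C *v y)"
    unfolding y_def by (rule posdef_inv_quad_eq) (rule posdef_convex_combination[OF assms])
  also have "\<dots> = u * (2 * (y \<bullet> a) - y \<bullet> (P *v y)) + v * (2 * (y \<bullet> b) - y \<bullet> (R *v y))"
    by (simp add: matrix_vector_mult_add_rdistrib scaleR_matrix_vector inner_add_right algebra_simps)
  also have "\<dots> \<le> u * (a \<bullet> (matrix_inv P *v a)) + v * (b \<bullet> (matrix_inv R *v b))"
    by (intro add_mono mult_left_mono posdef_inv_quad_ge P R uv)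
  finally show ?thesis .
qed

text \<open>Linear functionals given by a positive semidefinite weight \<open>R\<^sup>2\<close> are sums of values of quadratic forms.\<close>

lemma trace_gram:
  fixes R :: "real^'n^'n"
  assumes "symmetric_mat R"
  shows "trace (R ** R ** X) = (\<Sum>i\<in>UNIV. row i R \<bullet> (X *v row i R))"
proof -
  have "trace (R ** R ** X) = trace (R ** X ** R)"
    by (metis matrix_mul_assoc trace_mul_sym)
  also have "\<dots> = (\<Sum>i\<in>UNIV. (R *v (X *v (R *v axis i 1))) $ i)"
  proof -
    have "(R *v (X *v (R *v axis i 1))) $ i = ((R ** X ** R) *v axis i 1) $ i" for i
      by (simp only: matrix_vector_mul_assoc matrix_mul_assoc)
    then show ?thesis by (simp add: trace_def matrix_vector_mult_basis column_def)
  qed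
  also have "\<dots> = (\<Sum>i\<in>UNIV. row i R \<bullet> (X *v row i R))"
  proof (rule sum.cong[OF refl])
    fix i
    have "R *v axis i 1 = row i R"
      by (metis assms column_transpose matrix_vector_mult_basis row_transpose symmetric_mat_def)
    then show "(R *v (X *v (R *v axis i 1))) $ i = row i R \<bullet> (X *v row i R)"
      by (simp add: matrix_vector_mul_component row_def)
  qed
  finally show ?thesis .
qed

section \<open>Frobenius and spectral norms\<close>

lemma frobenius_norm_eq_norm: "frobenius_norm A = norm A"
  by (simp add: frobenius_norm_def norm_vec_def L2_set_def sum_nonneg)

lemma norm_transpose: "norm (transpose A) = norm (A :: real^'n^'m)"
proof -
  have "frobenius_norm (transpose A) = frobenius_norm A"
    unfolding frobenius_norm_def transpose_def by (subst sum.swap) simp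
  then show ?thesis by (simp add: frobenius_norm_eq_norm)
qed

lemma norm_matrix_vector_le: "norm (A *v x) \<le> spectral_norm A * norm (x :: real^'n)"
  unfolding spectral_norm_def by (rule onorm) (simp add: matrix_vector_mul_bounded_linear)

lemma spectral_norm_nonneg: "0 \<le> spectral_norm A"
  unfolding spectral_norm_def by (rule onorm_pos_le) (simp add: matrix_vector_mul_bounded_linear)

lemma spectral_norm_le:
  assumes "\<And>x. norm (A *v x) \<le> c * norm x"
  shows "spectral_norm A \<le> c"
  unfolding spectral_norm_def using assms by (rule onorm_le)

text \<open>The Frobenius norm is the Euclidean norm of the list of columns, and each column of \<open>A B\<close> is \<open>A\<close> applied to a column
  of \<open>B\<close>.\<close>

lemma norm_matrix_mult_le: "norm (A ** B) \<le> spectral_norm A * norm (B :: real^'p^'n)"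
proof -
  have row: "transpose (A ** B) $ j = A *v (transpose B $ j)" for j
    by (simp add: vec_eq_iff transpose_def matrix_matrix_mult_def matrix_vector_mult_def)
  have "norm (transpose (A ** B)) = L2_set (\<lambda>j. norm (A *v (transpose B $ j))) UNIV"
    by (simp only: norm_vec_def[of "transpose (A ** B)"] row)
  also have "\<dots> \<le> L2_set (\<lambda>j. spectral_norm A * norm (transpose B $ j)) UNIV"
    by (intro L2_set_mono norm_matrix_vector_le norm_ge_zero)
  also have "\<dots> = spectral_norm A * L2_set (\<lambda>j. norm (transpose B $ j)) UNIV"
    by (rule L2_set_right_distrib[symmetric]) (rule spectral_norm_nonneg)
  also have "\<dots> = spectral_norm A * norm (transpose B)"
    by (simp only: norm_vec_def[of "transpose B"])
  finally show ?thesis by (simp only: norm_transpose)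
qed

lemma norm_symmetric_mult_transpose_le:
  assumes "symmetric_mat S"
  shows "norm (S ** transpose X) \<le> spectral_norm X * norm S"
proof -
  have "S ** transpose X = transpose (X ** S)"
    using assms by (simp add: matrix_transpose_mul symmetric_mat_def)
  then show ?thesis by (simp add: norm_transpose norm_matrix_mult_le)
qed

lemma spectral_norm_mult: "spectral_norm (A ** B) \<le> spectral_norm A * spectral_norm (B :: real^'p^'n)"
proof (rule spectral_norm_le)
  fix x
  have "norm ((A ** B) *v x) \<le> spectral_norm A * norm (B *v x)"
    by (simp add: matrix_vector_mul_assoc[symmetric] norm_matrix_vector_le)
  also have "\<dots> \<le> spectral_norm A * (spectral_norm B * norm x)"
    by (intro mult_left_mono norm_matrix_vector_le spectral_norm_nonneg)
  finally show "norm ((A ** B) *v x) \<le> spectral_norm A * spectral_norm B * norm x"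
    by (simp add: mult.assoc)
qed

lemma spectral_norm_transpose_le: "spectral_norm (transpose A) \<le> spectral_norm (A :: real^'n^'m)"
proof (rule spectral_norm_le)
  fix x :: "real^'m"
  define y where "y = transpose A *v x"
  have "(norm y)\<^sup>2 = y \<bullet> (x v* A)" by (simp add: y_def power2_norm_eq_inner)
  also have "\<dots> = x \<bullet> (A *v y)" by (metis dot_lmul_matrix inner_commute)
  also have "\<dots> \<le> norm x * norm (A *v y)" by (rule norm_cauchy_schwarz)
  also have "\<dots> \<le> norm x * (spectral_norm A * norm y)"
    by (intro mult_left_mono norm_matrix_vector_le norm_ge_zero)
  finally have "norm y * norm y \<le> (spectral_norm A * norm x) * norm y"
    by (simp add: power2_eq_square mult_ac)
  then have "norm y \<le> spectral_norm A * norm x"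
    by (cases "norm y = 0") (auto simp: spectral_norm_nonneg)
  then show "norm (transpose A *v x) \<le> spectral_norm A * norm x" by (simp add: y_def)
qed

lemma spectral_norm_convex:
  assumes "0 \<le> u" "0 \<le> v"
  shows "spectral_norm (u *\<^sub>R A + v *\<^sub>R B) \<le> u * spectral_norm A + v * spectral_norm (B :: real^'n^'m)"
proof (rule spectral_norm_le)
  fix x
  have "norm ((u *\<^sub>R A + v *\<^sub>R B) *v x) \<le> u * norm (A *v x) + v * norm (B *v x)"
    using norm_triangle_ineq[of "u *\<^sub>R (A *v x)" "v *\<^sub>R (B *v x)"] assms
    by (simp add: matrix_vector_mult_add_rdistrib scaleR_matrix_vector)
  also have "\<dots> \<le> u * (spectral_norm A * norm x) + v * (spectral_norm B * norm x)"
    by (intro add_mono mult_left_mono norm_matrix_vector_le assms)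
  finally show "norm ((u *\<^sub>R A + v *\<^sub>R B) *v x) \<le> (u * spectral_norm A + v * spectral_norm B) * norm x"
    by (simp add: algebra_simps)
qed

text \<open>For a symmetric matrix the spectral norm is controlled by the quadratic form alone, by polarization.\<close>

lemma spectral_norm_symmetric_le:
  fixes S :: "real^'n^'n"
  assumes S: "symmetric_mat S" and le: "\<And>x. x \<bullet> (S *v x) \<le> c * (x \<bullet> x)" and ge: "\<And>x. - c * (x \<bullet> x) \<le> x \<bullet> (S *v x)"
  shows "spectral_norm S \<le> c"
proof (rule spectral_norm_le)
  fix x :: "real^'n"
  show "norm (S *v x) \<le> c * norm x"
  proof (cases "S *v x = 0 \<or> x = 0")
    case True
    have "0 \<le> c * (x \<bullet> x)" using le[of x] ge[of x] by linarith
    then have "0 \<le> c * norm x" by (cases "x = 0") (auto simp: zero_le_mult_iff power2_norm_eq_inner[symmetric])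
    with True show ?thesis by auto
  next
    case False
    \<comment> \<open>A multiple of \<open>S x\<close> of the same length as \<open>x\<close>, so that the two squares below add up to \<open>4 |x|\<^sup>2\<close>.\<close>
    define y where "y = (norm x / norm (S *v x)) *\<^sub>R (S *v x)"
    have ny: "y \<bullet> y = x \<bullet> x"
      using False by (simp add: y_def dot_square_norm[symmetric] power2_norm_eq_inner[symmetric] power2_eq_square)
    have "4 * (y \<bullet> (S *v x)) = (x + y) \<bullet> (S *v (x + y)) - (x - y) \<bullet> (S *v (x - y))"
      using symmetric_mat_inner[OF S, of x y]
      by (simp add: matrix_vector_right_distrib matrix_vector_mult_diff_distrib inner_add_left
          inner_add_right inner_diff_left inner_diff_right inner_commute)
    also have "\<dots> \<le> c * ((x + y) \<bullet> (x + y)) + c * ((x - y) \<bullet> (x - y))"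
      using le[of "x + y"] ge[of "x - y"] by linarith
    also have "\<dots> = c * (2 * (x \<bullet> x) + 2 * (y \<bullet> y))"
      by (simp add: inner_add_left inner_add_right inner_diff_left inner_diff_right algebra_simps)
    also have "\<dots> = 4 * (c * (norm x * norm x))"
      unfolding ny by (simp add: power2_norm_eq_inner[symmetric] power2_eq_square)
    finally have "y \<bullet> (S *v x) \<le> c * (norm x * norm x)" by simp
    moreover have "y \<bullet> (S *v x) = norm x * norm (S *v x)"
      using False by (simp add: y_def power2_norm_eq_inner[symmetric] power2_eq_square)
    ultimately have "norm x * norm (S *v x) \<le> norm x * (c * norm x)" by (simp add: mult_ac)
    then show ?thesis using False by simp
  qed
qed

lemma posdef_1_minus:
  fixes S :: "real^'n^'n"
  assumes S: "symmetric_mat S" and s: "spectral_norm S < 1"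
  shows "posdef (mat 1 - S)"
proof -
  have "0 < x \<bullet> ((mat 1 - S) *v x)" if "x \<noteq> 0" for x
  proof -
    have "x \<bullet> (S *v x) \<le> norm x * norm (S *v x)" by (rule norm_cauchy_schwarz)
    also have "\<dots> \<le> norm x * (spectral_norm S * norm x)"
      by (intro mult_left_mono norm_matrix_vector_le norm_ge_zero)
    also have "\<dots> < x \<bullet> x" using s \<open>x \<noteq> 0\<close>
      by (simp add: power2_norm_eq_inner[symmetric] power2_eq_square)
    finally show ?thesis by (simp add: matrix_vector_mult_diff_rdistrib inner_diff_right)
  qed
  then show ?thesis using S by (simp add: posdef_def symmetric_mat_diff)
qed

section \<open>Log-determinant under a near-identity congruence\<close>

lemma trace_mult_le: "trace (Y ** Z) \<le> norm Y * norm (Z :: real^'n^'m)"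
proof -
  have "trace (Y ** Z) = Y \<bullet> transpose Z"
    by (simp add: trace_def matrix_matrix_mult_def inner_vec_def transpose_def)
  then show ?thesis using norm_cauchy_schwarz[of Y "transpose Z"] by (simp add: norm_transpose)
qed

text \<open>The Neumann series without its first term is \<open>Y = (I - S)\<^sup>-\<^sup>1 S\<close>. It satisfies \<open>Y = S + S Y\<close>, and taking Frobenius norms in
  this equation bounds it.\<close>

lemma matrix_inv_1_minus:
  fixes S :: "real^'n^'n"
  assumes S: "symmetric_mat S" and s: "spectral_norm S < 1"
  obtains Y where "matrix_inv (mat 1 - S) = mat 1 + Y" "norm Y \<le> norm S / (1 - spectral_norm S)"
proof -
  define Y where "Y = matrix_inv (mat 1 - S) ** S"
  note inv = matrix_inv_mult[OF posdef_invertible[OF posdef_1_minus[OF S s]]]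
  have "matrix_inv (mat 1 - S) ** (mat 1 - S) = matrix_inv (mat 1 - S) - Y"
    by (simp add: Y_def matrix_mul_diff_right)
  then have 1: "matrix_inv (mat 1 - S) = mat 1 + Y" using inv(2) by (metis diff_add_cancel)
  have "(mat 1 - S) ** Y = S" by (simp add: Y_def matrix_mul_assoc inv)
  then have "Y = S + S ** Y" by (simp add: matrix_mul_diff_left algebra_simps)
  then have "norm Y = norm (S + S ** Y)" by (rule arg_cong)
  also have "\<dots> \<le> norm S + norm (S ** Y)" by (rule norm_triangle_ineq)
  also have "\<dots> \<le> norm S + spectral_norm S * norm Y" by (simp add: norm_matrix_mult_le)
  finally have "norm Y \<le> norm S + spectral_norm S * norm Y" .
  then have "norm Y \<le> norm S / (1 - spectral_norm S)" using s by (simp add: field_simps)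
  with 1 that show ?thesis by blast
qed

text \<open>Write \<open>T = X S X\<^sup>T\<close>. The tangent inequality for \<open>ln det\<close> at \<open>I - T\<close> gives
  \<open>ln det (I - S) \<le> ln det (I - T) + trace ((I - T)\<^sup>-\<^sup>1 (T - S))\<close>. With \<open>(I - T)\<^sup>-\<^sup>1 = I + Y\<close> the identity part is
  the trace term of the claim. The rest is at most the product of the Frobenius norms of \<open>Y\<close> and of
  \<open>T - S = (X - I) S X\<^sup>T + S (X - I)\<^sup>T\<close>; the former is at most the Frobenius norm of \<open>S\<close> divided by one minus its spectral
  norm, the latter at most \<open>2 \<delta>\<close> times the Frobenius norm of \<open>S\<close>.\<close>

theorem ln_det_congruence_perturbation:
  fixes S X :: "real^'n^'n"
  assumes S: "symmetric_mat S" and s: "spectral_norm S < 1"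
    and X: "spectral_norm X \<le> 1" and d: "spectral_norm (X - mat 1) \<le> \<delta>"
  shows "spectral_norm (X ** S ** transpose X) < 1"
    and "- (1/2) * ln (det (mat 1 - X ** S ** transpose X))
      \<le> - (1/2) * ln (det (mat 1 - S)) + (1/2) * trace (X ** S ** transpose X - S)
        + \<delta> * (2 + \<delta>) / (2 * (1 - spectral_norm S)) * (norm S)\<^sup>2"
proof -
  define T where "T = X ** S ** transpose X"
  have T: "symmetric_mat T" unfolding T_def by (rule symmetric_mat_congruence[OF S])
  have d0: "0 \<le> \<delta>" using d spectral_norm_nonneg[of "X - mat 1"] by linarith
  have XS: "spectral_norm (X ** S) \<le> spectral_norm S"
    using mult_right_mono[OF X spectral_norm_nonneg[of S]] spectral_norm_mult[of X S] by linarith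
  have "spectral_norm T \<le> spectral_norm (X ** S) * spectral_norm (transpose X)"
    unfolding T_def by (rule spectral_norm_mult)
  also have "\<dots> \<le> spectral_norm S * 1"
    using XS spectral_norm_transpose_le[of X] X by (intro mult_mono spectral_norm_nonneg) auto
  finally have TS: "spectral_norm T \<le> spectral_norm S" by simp
  then have t: "spectral_norm T < 1" using s by simp
  then show "spectral_norm (X ** S ** transpose X) < 1" by (simp add: T_def)
  have nSX: "norm (S ** transpose X) \<le> norm S"
    using norm_symmetric_mult_transpose_le[OF S, of X] mult_right_mono[OF X norm_ge_zero[of S]] by linarith
  have "norm T \<le> spectral_norm X * norm (S ** transpose X)"
    unfolding T_def matrix_mul_assoc[symmetric] by (rule norm_matrix_mult_le)
  also have "\<dots> \<le> 1 * norm S" using X nSX by (intro mult_mono) auto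
  finally have nT: "norm T \<le> norm S" by simp
  have "T - S = (X - mat 1) ** (S ** transpose X) + S ** transpose (X - mat 1)"
    by (simp add: T_def matrix_mul_diff_left matrix_mul_diff_right transpose_diff matrix_mul_assoc)
  then have "norm (T - S) \<le> norm ((X - mat 1) ** (S ** transpose X)) + norm (S ** transpose (X - mat 1))"
    by (metis norm_triangle_ineq)
  also have "\<dots> \<le> spectral_norm (X - mat 1) * norm (S ** transpose X) + spectral_norm (X - mat 1) * norm S"
    by (intro add_mono norm_matrix_mult_le norm_symmetric_mult_transpose_le S)
  also have "\<dots> \<le> \<delta> * norm S + \<delta> * norm S"
    using d nSX d0 by (intro add_mono mult_mono) auto
  also have "\<dots> \<le> \<delta> * (2 + \<delta>) * norm S"
    using d0 by (simp add: algebra_simps)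
  finally have TmS: "norm (T - S) \<le> \<delta> * (2 + \<delta>) * norm S" .
  obtain Y where Y: "matrix_inv (mat 1 - T) = mat 1 + Y" "norm Y \<le> norm T / (1 - spectral_norm T)"
    using matrix_inv_1_minus[OF T t] by blast
  have "norm Y \<le> norm S / (1 - spectral_norm S)"
    using Y(2) frac_le[of "norm S" "norm T" "1 - spectral_norm S" "1 - spectral_norm T"] nT TS s by simp
  then have "norm Y * norm (T - S) \<le> norm S / (1 - spectral_norm S) * (\<delta> * (2 + \<delta>) * norm S)"
    using TmS s by (intro mult_mono) auto
  also have "\<dots> = 2 * (\<delta> * (2 + \<delta>) / (2 * (1 - spectral_norm S)) * (norm S)\<^sup>2)"
    using s by (simp add: field_simps power2_eq_square)
  finally have YT: "trace (Y ** (T - S)) \<le> 2 * (\<delta> * (2 + \<delta>) / (2 * (1 - spectral_norm S)) * (norm S)\<^sup>2)"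
    using trace_mult_le[of Y "T - S"] by linarith
  have "ln (det (mat 1 - S)) \<le> ln (det (mat 1 - T)) + trace (matrix_inv (mat 1 - T) ** ((mat 1 - S) - (mat 1 - T)))"
    by (rule ln_det_le_linearization) (intro posdef_1_minus S s T t)+
  also have "(mat 1 - S) - (mat 1 - T) = T - S" by simp
  also have "trace (matrix_inv (mat 1 - T) ** (T - S)) = trace (T - S) + trace (Y ** (T - S))"
    by (simp add: Y(1) matrix_mul_add_left trace_add)
  finally show "- (1/2) * ln (det (mat 1 - X ** S ** transpose X))
      \<le> - (1/2) * ln (det (mat 1 - S)) + (1/2) * trace (X ** S ** transpose X - S)
        + \<delta> * (2 + \<delta>) / (2 * (1 - spectral_norm S)) * (norm S)\<^sup>2"
    using YT unfolding T_def[symmetric] by linarith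
qed

section \<open>The domain of \<open>Phi\<close>\<close>

text \<open>The set of matrices \<open>H\<close> on which \<open>Phi\<close> is considered. Being admissible with parameter \<open>\<alpha>\<close> means that \<open>H / \<alpha>\<close> lies in
  this set.\<close>

definition Phi_dom :: "real \<Rightarrow> real^'d^'d \<Rightarrow> real^'d^'d \<Rightarrow> bool" where
  "Phi_dom \<gamma> \<Theta> H \<longleftrightarrow> - (\<gamma> *\<^sub>R matrix_inv \<Theta>) \<preceq> H \<and> H \<preceq> \<gamma> *\<^sub>R matrix_inv \<Theta>"

lemma Phi_dom_iff:
  fixes \<Theta> :: "real^'d^'d"
  assumes \<Theta>: "posdef \<Theta>"
  shows "Phi_dom \<gamma> \<Theta> H \<longleftrightarrow> symmetric_mat H \<and>
    (\<forall>x. \<bar>x \<bullet> (H *v x)\<bar> \<le> \<gamma> * (x \<bullet> (matrix_inv \<Theta> *v x)))"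
proof -
  let ?J = "matrix_inv \<Theta>"
  have J: "symmetric_mat ?J" using posdef_sym[OF posdef_matrix_inv[OF \<Theta>]] .
  have 1: "symmetric_mat H" if "symmetric_mat (\<gamma> *\<^sub>R ?J - H)"
    using symmetric_mat_diff[OF symmetric_mat_scaleR[OF J, of \<gamma>] that] by simp
  have 2: "symmetric_mat (\<gamma> *\<^sub>R ?J - H)" "symmetric_mat (H + \<gamma> *\<^sub>R ?J)" if "symmetric_mat H"
    using that J by (simp_all add: symmetric_mat_diff symmetric_mat_add symmetric_mat_scaleR)
  show ?thesis unfolding Phi_dom_def loewner_le_def psd_def abs_le_iff
    using 1 2 by (auto simp: matrix_vector_mult_add_rdistrib matrix_vector_mult_diff_rdistrib
        scaleR_matrix_vector inner_diff_right inner_add_right) (smt (verit))+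
qed

text \<open>The congruence by \<open>\<Theta>\<^sup>1\<^sup>/\<^sup>2\<close> turns the bounds by multiples of \<open>\<Theta>\<^sup>-\<^sup>1\<close> into bounds by multiples of the identity. So
  every inverse and every logarithm in \<open>Phi\<close> is taken of a positive definite matrix, and the denominator is positive.\<close>

lemma Phi_dom_scaled:
  fixes \<Theta> :: "real^'d^'d"
  assumes \<Theta>: "posdef \<Theta>" and dom: "Phi_dom \<gamma> \<Theta> H" and \<gamma>: "\<gamma> < 1"
  defines "S \<equiv> psd_sqrt \<Theta> ** H ** psd_sqrt \<Theta>"
  shows "symmetric_mat S" "spectral_norm S \<le> \<gamma>" "posdef (mat 1 - S)" "posdef (matrix_inv \<Theta> - H)"
proof -
  define L where "L = psd_sqrt \<Theta>"
  have L: "posdef L" "L ** L = \<Theta>" "transpose L = L"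
    using posdef_psd_sqrt[OF \<Theta>] psd_sqrt[OF posdef_psd[OF \<Theta>]] by (auto simp: L_def posdef_def symmetric_mat_def)
  have H: "symmetric_mat H" and Hx: "\<And>x. \<bar>x \<bullet> (H *v x)\<bar> \<le> \<gamma> * (x \<bullet> (matrix_inv \<Theta> *v x))"
    using dom Phi_dom_iff[OF \<Theta>] by auto
  have SL: "S = L ** H ** transpose L" by (simp add: S_def L_def[symmetric] L(3))
  show S: "symmetric_mat S" unfolding SL by (rule symmetric_mat_congruence[OF H])
  have "L ** (L ** matrix_inv \<Theta>) = mat 1"
    using matrix_inv_mult(1)[OF posdef_invertible[OF \<Theta>]] by (simp add: L(2) matrix_mul_assoc)
  then have "(L ** matrix_inv \<Theta>) ** L = mat 1" using matrix_left_right_inverse by blast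
  then have "L ** matrix_inv \<Theta> ** transpose L = mat 1" by (simp add: L(3))
  then have LJL: "(transpose L *v x) \<bullet> (matrix_inv \<Theta> *v (transpose L *v x)) = x \<bullet> x" for x
    using inner_congruence[of x L "matrix_inv \<Theta>"] by simp
  have Sx: "\<bar>x \<bullet> (S *v x)\<bar> \<le> \<gamma> * (x \<bullet> x)" for x
    using Hx[of "transpose L *v x"] unfolding LJL SL inner_congruence .
  show s: "spectral_norm S \<le> \<gamma>"
  proof (rule spectral_norm_symmetric_le[OF S])
    show "x \<bullet> (S *v x) \<le> \<gamma> * (x \<bullet> x)" "- \<gamma> * (x \<bullet> x) \<le> x \<bullet> (S *v x)" for x
      using Sx[of x] by auto
  qed
  then show "posdef (mat 1 - S)" using posdef_1_minus[OF S] \<gamma> by simp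
  have J: "posdef (matrix_inv \<Theta>)" by (rule posdef_matrix_inv[OF \<Theta>])
  have "0 < x \<bullet> ((matrix_inv \<Theta> - H) *v x)" if "x \<noteq> 0" for x
  proof -
    have "0 < x \<bullet> (matrix_inv \<Theta> *v x)" using J that by (simp add: posdef_def)
    then have "\<gamma> * (x \<bullet> (matrix_inv \<Theta> *v x)) < x \<bullet> (matrix_inv \<Theta> *v x)" using \<gamma> by simp
    then show ?thesis using Hx[of x] by (simp add: matrix_vector_mult_diff_rdistrib inner_diff_right)
  qed
  then show "posdef (matrix_inv \<Theta> - H)"
    using J H by (simp add: posdef_def symmetric_mat_diff)
qed

section \<open>Gaussian integrals\<close>

lemma nn_integral_lborel_prod_vec:
  fixes f :: "'n::finite \<Rightarrow> real \<Rightarrow> ennreal"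
  assumes f: "\<And>i. f i \<in> borel_measurable borel"
  shows "(\<integral>\<^sup>+x. (\<Prod>i\<in>UNIV. f i (x $ i)) \<partial>(lborel :: (real^'n) measure)) = (\<Prod>i\<in>UNIV. \<integral>\<^sup>+t. f i t \<partial>lborel)"
proof -
  let ?e = "\<lambda>i. axis i (1::real) :: real^'n"
  have inj: "inj ?e" by (auto simp: inj_on_def axis_eq_axis)
  have B: "(Basis :: (real^'n) set) = range ?e" by (auto simp: Basis_vec_def)
  define g where "g b = f (inv ?e b)" for b
  have ge: "g (?e i) = f i" for i by (simp add: g_def inv_f_f[OF inj])
  have 1: "(\<Prod>i\<in>UNIV. f i (x $ i)) = (\<Prod>b\<in>Basis. g b (x \<bullet> b))" for x :: "real^'n"
    unfolding B by (subst prod.reindex[OF inj]) (simp add: ge inner_axis)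
  have 2: "(\<Prod>i\<in>UNIV. \<integral>\<^sup>+t. f i t \<partial>lborel) = (\<Prod>b\<in>Basis. \<integral>\<^sup>+t. g b t \<partial>lborel)"
    unfolding B by (subst prod.reindex[OF inj]) (simp add: ge)
  show ?thesis unfolding 1 2 by (rule nn_integral_lborel_prod) (auto simp: g_def f)
qed

lemma nn_integral_normal_density: "0 < \<sigma> \<Longrightarrow> (\<integral>\<^sup>+t. ennreal (normal_density \<mu> \<sigma> t) \<partial>lborel) = 1"
  using prob_space.emeasure_space_1[OF prob_space_normal_density, of \<sigma> \<mu>]
  by (simp add: emeasure_density)

text \<open>Completing the square turns the integrand into a multiple of the normal density with mean \<open>c / (1 - d)\<close> and variance
  \<open>1 / (1 - d)\<close>.\<close>

lemma nn_integral_std_normal_exp_quad: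
  assumes d: "d < 1"
  shows "(\<integral>\<^sup>+t. ennreal (exp (c * t + (1/2) * d * t\<^sup>2)) * ennreal (std_normal_density t) \<partial>lborel)
    = ennreal (exp (c\<^sup>2 / (2 * (1 - d))) / sqrt (1 - d))"
proof -
  let ?s = "1 / sqrt (1 - d)" and ?m = "c / (1 - d)"
  let ?K = "exp (c\<^sup>2 / (2 * (1 - d))) / sqrt (1 - d)"
  have s2: "?s\<^sup>2 = 1 / (1 - d)" using d by (simp add: power_divide)
  have e: "exp (c * t + (1/2) * d * t\<^sup>2) * std_normal_density t = ?K * normal_density ?m ?s t" for t
  proof -
    have x: "c * t + (1/2) * d * t\<^sup>2 + - t\<^sup>2 / 2 = c\<^sup>2 / (2 * (1 - d)) + - (t - ?m)\<^sup>2 / (2 * ?s\<^sup>2)"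
    proof -
      have "(t - c / e)\<^sup>2 * e = t\<^sup>2 * e - 2 * t * c + c\<^sup>2 / e" if "0 < e" for e
        using that by (simp add: power2_eq_square field_simps)
      from this[of "1 - d"] d have 1: "(t - ?m)\<^sup>2 * (1 - d) = t\<^sup>2 * (1 - d) - 2 * t * c + c\<^sup>2 / (1 - d)"
        by simp
      have 2: "- (t - ?m)\<^sup>2 / (2 * (1 / (1 - d))) = - ((t - ?m)\<^sup>2 * (1 - d)) / 2"
        and 3: "c\<^sup>2 / (2 * (1 - d)) = (c\<^sup>2 / (1 - d)) / 2" by simp_all
      have 4: "t\<^sup>2 * (1 - d) = t\<^sup>2 - d * t\<^sup>2" by (simp add: algebra_simps)
      show ?thesis unfolding s2 2 3 1 4 by (simp add: diff_divide_distrib add_divide_distrib)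
    qed
    have y: "1 / sqrt (2 * pi * ?s\<^sup>2) = sqrt (1 - d) / sqrt (2 * pi)"
      using d unfolding s2 by (simp add: real_sqrt_divide)
    have "exp (c * t + (1/2) * d * t\<^sup>2) * std_normal_density t
      = (1 / sqrt (2 * pi)) * exp (c * t + (1/2) * d * t\<^sup>2 + - t\<^sup>2 / 2)"
      unfolding std_normal_density_def exp_add by (simp only: mult_ac)
    also have "\<dots> = (1 / sqrt (2 * pi)) * exp (c\<^sup>2 / (2 * (1 - d))) * exp (- (t - ?m)\<^sup>2 / (2 * ?s\<^sup>2))"
      unfolding x exp_add by simp
    also have "\<dots> = ?K * normal_density ?m ?s t"
      unfolding normal_density_def y using d by (simp add: field_simps)
    finally show ?thesis .
  qed
  have "(\<integral>\<^sup>+t. ennreal (exp (c * t + (1/2) * d * t\<^sup>2)) * ennreal (std_normal_density t) \<partial>lborel)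
    = (\<integral>\<^sup>+t. ennreal ?K * ennreal (normal_density ?m ?s t) \<partial>lborel)"
    using d by (simp only: ennreal_mult'[symmetric] exp_ge_zero e) (simp add: ennreal_mult'[symmetric])
  also have "\<dots> = ennreal ?K * (\<integral>\<^sup>+t. ennreal (normal_density ?m ?s t) \<partial>lborel)"
    by (rule nn_integral_cmult) simp
  also have "\<dots> = ennreal ?K" using d by (subst nn_integral_normal_density) auto
  finally show ?thesis .
qed

definition std_gaussian_density :: "real^'d \<Rightarrow> real" where
  "std_gaussian_density x = (\<Prod>i\<in>UNIV. std_normal_density (x $ i))"

lemma measurable_std_gaussian_density [measurable]: "std_gaussian_density \<in> borel_measurable borel"
  unfolding std_gaussian_density_def by measurable

lemma std_gaussian_density_radial:
  "std_gaussian_density x = (1 / sqrt (2 * pi)) ^ CARD('d) * exp (- (norm x)\<^sup>2 / 2)" for x :: "real^'d"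
proof -
  have "(norm x)\<^sup>2 = (\<Sum>i\<in>UNIV. (x $ i)\<^sup>2)"
    unfolding power2_norm_eq_inner by (simp add: inner_vec_def power2_eq_square)
  then have "(\<Prod>i\<in>UNIV. exp (- (x $ i)\<^sup>2 / 2)) = exp (- (norm x)\<^sup>2 / 2)"
    by (simp add: exp_sum[symmetric] sum_negf sum_divide_distrib)
  then show ?thesis unfolding std_gaussian_density_def std_normal_density_def prod.distrib by simp
qed

lemma nn_integral_std_gaussian_density:
  "(\<integral>\<^sup>+x. ennreal (std_gaussian_density x) \<partial>(lborel :: (real^'d) measure)) = 1"
  unfolding std_gaussian_density_def
  using nn_integral_lborel_prod_vec[of "\<lambda>_::'d. \<lambda>t. ennreal (std_normal_density t)"]
  by (simp add: prod_ennreal nn_integral_normal_density)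

lemma nn_integral_lborel_translate:
  fixes g :: "'a::euclidean_space \<Rightarrow> ennreal"
  assumes [measurable]: "g \<in> borel_measurable borel"
  shows "(\<integral>\<^sup>+x. g (c + x) \<partial>lborel) = (\<integral>\<^sup>+x. g x \<partial>lborel)"
  by (subst (2) lborel_distr_plus[of c, symmetric]) (simp add: nn_integral_distr)

lemma measurable_matrix_vector_mult [measurable]: "(\<lambda>x. (A :: real^'n^'m) *v x) \<in> borel_measurable borel"
  by (intro borel_measurable_continuous_onI linear_continuous_on) (simp add: matrix_vector_mul_bounded_linear)

lemma norm_orthogonal_matrix_mult:
  fixes R :: "real^'n^'n"
  assumes "orthogonal_matrix R"
  shows "norm (R *v x) = norm x"
proof -
  have "(R *v x) \<bullet> (R *v x) = x \<bullet> (transpose R *v (R *v x))"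
    by (metis dot_lmul_matrix inner_commute transpose_matrix_vector)
  also have "\<dots> = x \<bullet> x"
    by (simp add: orthogonal_matrix_mult[OF assms] matrix_vector_mul_assoc del: transpose_matrix_vector)
  finally show ?thesis by (simp add: norm_eq_sqrt_inner)
qed

text \<open>Let \<open>h\<close> be the standard Gaussian density: a radial function of integral one. Insert the factor
  \<open>1 = \<integral> h (y - R x) dy\<close>, exchange the integrals, rewrite \<open>h (y - R x) = h (x - R\<^sup>T y)\<close> by radiality, and translate
  \<open>x\<close> by \<open>R\<^sup>T y\<close>. The integrand becomes \<open>g (y + R x) h x\<close>, whose \<open>y\<close>-integral is that of \<open>g\<close> by translation
  invariance. So rotation invariance of Lebesgue measure follows from translation invariance and Tonelli's theorem.\<close>

theorem nn_integral_lborel_orthogonal: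
  fixes R :: "real^'n^'n" and g :: "real^'n \<Rightarrow> ennreal"
  assumes R: "orthogonal_matrix R" and g[measurable]: "g \<in> borel_measurable borel"
  shows "(\<integral>\<^sup>+x. g (R *v x) \<partial>lborel) = (\<integral>\<^sup>+x. g x \<partial>lborel)"
proof -
  define h :: "real^'n \<Rightarrow> ennreal" where "h x = ennreal (std_gaussian_density x)" for x
  have h[measurable]: "h \<in> borel_measurable borel" unfolding h_def by measurable
  have h1: "(\<integral>\<^sup>+x. h x \<partial>lborel) = 1" unfolding h_def by (rule nn_integral_std_gaussian_density)
  \<comment> \<open>Radiality: \<open>y - R x = - R (x - R\<^sup>T y)\<close>.\<close>
  have hR: "h (- (R *v x) + y) = h (- (transpose R *v y) + x)" for x y
  proof -
    have "- (R *v x) + y = R *v (- (- (transpose R *v y) + x))"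
      using orthogonal_matrix_mult(2)[OF R]
      by (simp add: matrix_vector_mult_diff_distrib matrix_vector_mul_assoc del: transpose_matrix_vector)
    then have "norm (- (R *v x) + y) = norm (- (transpose R *v y) + x)"
      by (metis R norm_minus_cancel norm_orthogonal_matrix_mult)
    then show ?thesis by (simp only: h_def std_gaussian_density_radial)
  qed
  have Ry: "R *v (transpose R *v y + x) = y + R *v x" for x y
    using orthogonal_matrix_mult(2)[OF R]
    by (simp add: matrix_vector_right_distrib matrix_vector_mul_assoc del: transpose_matrix_vector)
  interpret pair_sigma_finite "lborel :: (real^'n) measure" "lborel :: (real^'n) measure" ..
  have "(\<integral>\<^sup>+x. g (R *v x) \<partial>lborel) = (\<integral>\<^sup>+x. g (R *v x) * (\<integral>\<^sup>+y. h (- (R *v x) + y) \<partial>lborel) \<partial>lborel)"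
    by (simp only: nn_integral_lborel_translate[OF h] h1 mult_1_right)
  also have "\<dots> = (\<integral>\<^sup>+x. \<integral>\<^sup>+y. g (R *v x) * h (- (R *v x) + y) \<partial>lborel \<partial>lborel)"
    by (simp add: nn_integral_cmult)
  also have "\<dots> = (\<integral>\<^sup>+y. \<integral>\<^sup>+x. g (R *v x) * h (- (R *v x) + y) \<partial>lborel \<partial>lborel)"
    by (rule lborel_pair.Fubini'[symmetric]) measurable
  also have "\<dots> = (\<integral>\<^sup>+y. \<integral>\<^sup>+x. g (R *v x) * h (- (transpose R *v y) + x) \<partial>lborel \<partial>lborel)"
    by (simp only: hR)
  also have "\<dots> = (\<integral>\<^sup>+y. \<integral>\<^sup>+x. g (R *v (transpose R *v y + x)) * h (- (transpose R *v y) + (transpose R *v y + x)) \<partial>lborel \<partial>lborel)"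
    by (rule nn_integral_cong, rule nn_integral_lborel_translate[symmetric]) measurable
  also have "\<dots> = (\<integral>\<^sup>+y. \<integral>\<^sup>+x. g (y + R *v x) * h x \<partial>lborel \<partial>lborel)"
    by (simp only: Ry) simp
  also have "\<dots> = (\<integral>\<^sup>+x. \<integral>\<^sup>+y. g (y + R *v x) * h x \<partial>lborel \<partial>lborel)"
    by (rule lborel_pair.Fubini') measurable
  also have "\<dots> = (\<integral>\<^sup>+x. (\<integral>\<^sup>+y. g (R *v x + y) \<partial>lborel) * h x \<partial>lborel)"
    by (simp add: nn_integral_multc add.commute)
  also have "\<dots> = (\<integral>\<^sup>+x. g x \<partial>lborel)"
    by (simp add: nn_integral_lborel_translate nn_integral_cmult h1)
  finally show ?thesis .
qed

lemma std_gaussian_eq: "std_gaussian = density lborel (\<lambda>x. ennreal (std_gaussian_density x))"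
  by (simp add: std_gaussian_def std_gaussian_density_def)

lemma prob_space_std_gaussian: "prob_space (std_gaussian :: (real^'d) measure)"
proof
  show "emeasure (std_gaussian :: (real^'d) measure) (space std_gaussian) = 1"
    by (simp add: std_gaussian_eq emeasure_density nn_integral_std_gaussian_density)
qed

lemma sets_std_gaussian [simp, measurable_cong]: "sets std_gaussian = sets borel"
  by (simp add: std_gaussian_def)

lemma prob_space_gaussian: "prob_space (gaussian \<mu> \<Sigma>)"
  unfolding gaussian_def by (rule prob_space.prob_space_distr[OF prob_space_std_gaussian]) measurable

lemma sets_gaussian [simp, measurable_cong]: "sets (gaussian \<mu> \<Sigma>) = sets borel"
  by (simp add: gaussian_def)

text \<open>In an orthonormal eigenbasis of \<open>S\<close> the integrand is a product of functions of one coordinate, and the standard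
  Gaussian is invariant under the change of basis.\<close>

theorem nn_integral_std_gaussian_exp_quad:
  fixes S :: "real^'d^'d"
  assumes S: "symmetric_mat S" and pd: "posdef (mat 1 - S)"
  shows "(\<integral>\<^sup>+x. ennreal (exp (b \<bullet> x + (1/2) * (x \<bullet> (S *v x)))) \<partial>std_gaussian)
    = ennreal (exp ((1/2) * (b \<bullet> (matrix_inv (mat 1 - S) *v b)) - (1/2) * ln (det (mat 1 - S))))"
proof -
  obtain R d where R: "orthogonal_matrix R" "S = R ** diag_mat d ** transpose R"
    using symmetric_mat_diagonalization[OF S] by blast
  have IS: "mat 1 - S = R ** diag_mat (\<lambda>i. 1 - d i) ** transpose R"
    by (simp add: R(2) diag_mat_diff[symmetric] mat_1_diag[symmetric] matrix_mul_diff_left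
        matrix_mul_diff_right orthogonal_matrix_mult[OF R(1)])
  have d: "d i < 1" for i
  proof -
    have "0 < (R *v axis i 1) \<bullet> ((mat 1 - S) *v (R *v axis i 1))"
      using pd orthogonal_matrix_mult_axis_nonzero[OF R(1)] by (simp add: posdef_def)
    then show ?thesis unfolding IS inner_orthogonal_conj_axis[OF R(1)] by simp
  qed
  have "(mat 1 - S) ** (R ** diag_mat (\<lambda>i. 1 / (1 - d i)) ** transpose R)
    = R ** (diag_mat (\<lambda>i. 1 - d i) ** (transpose R ** R) ** diag_mat (\<lambda>i. 1 / (1 - d i))) ** transpose R"
    by (simp only: IS matrix_mul_assoc)
  also have "diag_mat (\<lambda>i. 1 - d i) ** (transpose R ** R) ** diag_mat (\<lambda>i. 1 / (1 - d i)) = mat 1"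
  proof -
    have "(1 - d i) * (1 / (1 - d i)) = 1" for i using d[of i] by simp
    then show ?thesis by (simp only: orthogonal_matrix_mult[OF R(1)] matrix_mul_rid diag_mat_mult mat_1_diag mult_1_right)
  qed
  finally have inv: "matrix_inv (mat 1 - S) = R ** diag_mat (\<lambda>i. 1 / (1 - d i)) ** transpose R"
    by (intro matrix_inv_eqI) (simp add: orthogonal_matrix_mult[OF R(1)])
  define c where "c = transpose R *v b"
  have quad: "b \<bullet> (matrix_inv (mat 1 - S) *v b) = (\<Sum>i\<in>UNIV. (c $ i)\<^sup>2 / (1 - d i))"
    unfolding inv inner_congruence inner_diag_mat c_def by simp
  have det: "det (mat 1 - S) = (\<Prod>i\<in>UNIV. 1 - d i)"
    unfolding IS by (simp add: det_orthogonal_conj[OF R(1)] det_diag_mat)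
  have ln: "ln (det (mat 1 - S)) = (\<Sum>i\<in>UNIV. ln (1 - d i))"
    unfolding det by (rule ln_prod) (use d in \<open>auto simp: less_imp_neq\<close>)
  have rot: "b \<bullet> (R *v x) + (1/2) * ((R *v x) \<bullet> (S *v (R *v x))) = (\<Sum>i\<in>UNIV. c $ i * x $ i + (1/2) * d i * (x $ i)\<^sup>2)" for x
  proof -
    have "transpose R *v (R *v x) = x"
      by (simp add: orthogonal_matrix_mult[OF R(1)] matrix_vector_mul_assoc del: transpose_matrix_vector)
    then have "(R *v x) \<bullet> (S *v (R *v x)) = (\<Sum>i\<in>UNIV. d i * (x $ i)\<^sup>2)"
      unfolding R(2) inner_congruence by (simp only: inner_diag_mat)
    moreover have "b \<bullet> (R *v x) = c \<bullet> x" by (simp add: c_def dot_lmul_matrix)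
    ultimately show ?thesis by (simp add: inner_vec_def sum.distrib sum_distrib_left mult.assoc)
  qed
  let ?f = "\<lambda>x. ennreal (exp (b \<bullet> x + (1/2) * (x \<bullet> (S *v x))))"
  have "(\<integral>\<^sup>+x. ?f x \<partial>std_gaussian) = (\<integral>\<^sup>+x. ?f x * ennreal (std_gaussian_density x) \<partial>lborel)"
    unfolding std_gaussian_eq by (subst nn_integral_density) (auto simp: mult.commute)
  also have "\<dots> = (\<integral>\<^sup>+x. ?f (R *v x) * ennreal (std_gaussian_density (R *v x)) \<partial>lborel)"
    by (rule nn_integral_lborel_orthogonal[OF R(1), symmetric]) measurable
  also have "\<dots> = (\<integral>\<^sup>+x. (\<Prod>i\<in>UNIV. ennreal (exp (c $ i * x $ i + (1/2) * d i * (x $ i)\<^sup>2)) * ennreal (std_normal_density (x $ i))) \<partial>lborel)"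
    by (simp only: rot std_gaussian_density_radial norm_orthogonal_matrix_mult[OF R(1)])
      (simp only: std_gaussian_density_radial[symmetric] std_gaussian_density_def prod.distrib
        prod_ennreal exp_ge_zero normal_density_nonneg exp_sum finite)
  also have "\<dots> = (\<Prod>i\<in>UNIV. \<integral>\<^sup>+t. ennreal (exp (c $ i * t + (1/2) * d i * t\<^sup>2)) * ennreal (std_normal_density t) \<partial>lborel)"
    by (rule nn_integral_lborel_prod_vec) measurable
  also have "\<dots> = (\<Prod>i\<in>UNIV. ennreal (exp ((1/2) * ((c $ i)\<^sup>2 / (1 - d i)) - (1/2) * ln (1 - d i))))"
  proof (rule prod.cong[OF refl])
    fix i
    have "exp ((1/2) * ln (1 - d i)) = sqrt (1 - d i)"
      using d[of i] by (simp add: ln_sqrt[symmetric])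
    then have "exp ((c $ i)\<^sup>2 / (2 * (1 - d i))) / sqrt (1 - d i)
      = exp ((1/2) * ((c $ i)\<^sup>2 / (1 - d i)) - (1/2) * ln (1 - d i))"
      unfolding exp_diff by simp
    then show "(\<integral>\<^sup>+t. ennreal (exp (c $ i * t + (1/2) * d i * t\<^sup>2)) * ennreal (std_normal_density t) \<partial>lborel)
      = ennreal (exp ((1/2) * ((c $ i)\<^sup>2 / (1 - d i)) - (1/2) * ln (1 - d i)))"
      by (simp only: nn_integral_std_normal_exp_quad[OF d])
  qed
  also have "\<dots> = ennreal (exp (\<Sum>i\<in>UNIV. (1/2) * ((c $ i)\<^sup>2 / (1 - d i)) - (1/2) * ln (1 - d i)))"
    by (simp only: prod_ennreal exp_ge_zero exp_sum finite)
  also have "(\<Sum>i\<in>UNIV. (1/2) * ((c $ i)\<^sup>2 / (1 - d i)) - (1/2) * ln (1 - d i))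
    = (1/2) * (b \<bullet> (matrix_inv (mat 1 - S) *v b)) - (1/2) * ln (det (mat 1 - S))"
    unfolding quad ln by (simp only: sum_subtractf sum_distrib_left)
  finally show ?thesis .
qed

section \<open>Exponential moments of quadratic forms of Gaussian vectors\<close>

text \<open>The block identities starting here evaluate the quadratic forms in \<open>Phi\<close> at the vector \<open>[\<mu>; 1]\<close>.\<close>

lemma inner_vec_snoc: "vec_snoc a s \<bullet> vec_snoc b t = a \<bullet> b + s * t"
proof -
  have U: "(UNIV :: ('n + unit) set) = UNIV <+> UNIV" by (simp add: UNIV_Plus_UNIV)
  show ?thesis unfolding inner_vec_def U by (subst sum.Plus) (simp_all add: vec_snoc_def)
qed

lemma append_col_mult_vec: "append_col H h *v vec_snoc u t = H *v u + t *\<^sub>R h"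
  by (simp add: vec_eq_iff matrix_vector_mul_component append_col_def inner_vec_snoc mult.commute)

lemma append_row_mult_vec: "append_row A r *v x = vec_snoc (A *v x) (r \<bullet> x)"
  by (auto simp: vec_eq_iff matrix_vector_mul_component append_row_def vec_snoc_def split: sum.split)

lemma bordered_quad:
  "vec_snoc u 1 \<bullet> (bordered H h *v vec_snoc u 1) = u \<bullet> (H *v u) + 2 * (h \<bullet> u)"
  by (simp add: bordered_def append_row_mult_vec append_col_mult_vec inner_vec_snoc inner_add_right inner_commute)

lemma append_basis_row_mult_vec: "append_basis_row A *v vec_snoc u 1 = vec_snoc (A *v vec_snoc u 1) 1"
  by (simp add: append_basis_row_def append_row_mult_vec inner_axis' vec_snoc_def)

lemma trace_outer_square: "trace (outer_square z ** X) = z \<bullet> (X *v z)" for z :: "real^'n"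
proof -
  have "trace (outer_square z ** X) = (\<Sum>i\<in>UNIV. \<Sum>k\<in>UNIV. z $ i * z $ k * X $ k $ i)"
    by (simp add: trace_def outer_square_def matrix_matrix_mult_def)
  also have "\<dots> = (\<Sum>k\<in>UNIV. \<Sum>i\<in>UNIV. z $ i * z $ k * X $ k $ i)" by (rule sum.swap)
  also have "\<dots> = z \<bullet> (X *v z)"
    by (simp add: inner_vec_def matrix_vector_mult_def sum_distrib_left mult_ac)
  finally show ?thesis .
qed

lemma outer_square_congruence: "B ** outer_square z ** transpose B = outer_square (B *v z)" for z :: "real^'n"
proof -
  have "(B ** outer_square z) $ i $ k = (B *v z) $ i * z $ k" for i k
    by (simp add: matrix_matrix_mult_def outer_square_def matrix_vector_mult_def sum_distrib_right mult.assoc)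
  then show ?thesis
    by (simp add: vec_eq_iff matrix_matrix_mult_def[of "B ** outer_square z"] transpose_def)
      (simp add: outer_square_def matrix_vector_mult_def sum_distrib_left mult_ac)
qed

lemma inner_congruence_transpose: "x \<bullet> ((transpose C ** N ** C) *v x) = (C *v x) \<bullet> (N *v (C *v x))"
  for x :: "real^'n" and C :: "real^'n^'m"
  using inner_congruence[of x "transpose C" N] by simp

text \<open>Substituting \<open>\<zeta> = \<mu> + T x\<close> with \<open>T = \<Theta>\<^sup>1\<^sup>/\<^sup>2\<close> reduces the integral to the standard Gaussian one with quadratic part
  \<open>T H T\<close> and linear part \<open>T b\<close>, where \<open>b = H \<mu> + h\<close>. For \<open>X = \<Theta>\<^sup>1\<^sup>/\<^sup>2 \<Theta>s\<^sup>-\<^sup>1\<^sup>/\<^sup>2\<close> and \<open>S = \<Theta>s\<^sup>1\<^sup>/\<^sup>2 H \<Theta>s\<^sup>1\<^sup>/\<^sup>2\<close>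
  one has \<open>T H T = X S X\<^sup>T\<close>, and \<open>X\<close> is a contraction because \<open>\<Theta> \<preceq> \<Theta>s\<close>. So the log-determinant term is a
  congruence perturbation. For the inverse quadratic form the variational formula is used in place of
  \<open>(\<Theta>\<^sup>-\<^sup>1 - H)\<^sup>-\<^sup>1 \<preceq> (\<Theta>s\<^sup>-\<^sup>1 - H)\<^sup>-\<^sup>1\<close>, since \<open>\<Theta>\<close> may be singular.\<close>

theorem gaussian_exp_quad_le_Phi:
  fixes \<Theta> \<Theta>s H :: "real^'d^'d"
  assumes \<Theta>s: "posdef \<Theta>s" and \<Theta>: "psd \<Theta>" "\<Theta> \<preceq> \<Theta>s"
    and \<delta>: "spectral_norm (psd_sqrt \<Theta> ** matrix_inv (psd_sqrt \<Theta>s) - mat 1) \<le> \<delta>"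
    and \<gamma>: "\<gamma> < 1" and H: "Phi_dom \<gamma> \<Theta>s H"
  shows "(\<integral>\<^sup>+\<zeta>. ennreal (exp (h \<bullet> \<zeta> + (1/2) * (\<zeta> \<bullet> (H *v \<zeta>)))) \<partial>gaussian \<mu> \<Theta>)
    \<le> ennreal (exp (Phi \<Theta>s \<delta> h H \<Theta> (outer_square (vec_snoc \<mu> 1))))"
proof -
  define L where "L = psd_sqrt \<Theta>s"
  define T where "T = psd_sqrt \<Theta>"
  have L: "posdef L" "L ** L = \<Theta>s" "transpose L = L"
    using posdef_psd_sqrt[OF \<Theta>s] psd_sqrt[OF posdef_psd[OF \<Theta>s]] by (auto simp: L_def posdef_def symmetric_mat_def)
  have T: "psd T" "T ** T = \<Theta>" "transpose T = T"
    using psd_sqrt[OF \<Theta>(1)] by (auto simp: T_def psd_def symmetric_mat_def)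
  define J where "J = matrix_inv L"
  have J: "L ** J = mat 1" "J ** L = mat 1" unfolding J_def by (rule matrix_inv_mult[OF posdef_invertible[OF L(1)]])+
  have JT: "transpose J = J"
    using symmetric_mat_inv[OF posdef_sym[OF L(1)] posdef_invertible[OF L(1)]] by (simp add: J_def symmetric_mat_def)
  have \<Theta>sJ: "matrix_inv \<Theta>s = J ** J"
    unfolding J_def L_def by (rule matrix_inv_eq_sqrt_inv_square[OF \<Theta>s])
  define X where "X = T ** J"
  have XT: "transpose X = J ** T" by (simp add: X_def matrix_transpose_mul JT T)
  define S where "S = L ** H ** L"
  note dom = Phi_dom_scaled[OF \<Theta>s H \<gamma>, folded L_def, folded S_def]
  have Hsym: "symmetric_mat H" using H Phi_dom_iff[OF \<Theta>s] by simp
  have XSX: "X ** S ** transpose X = T ** H ** T"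
  proof -
    have "X ** S ** transpose X = T ** (J ** L) ** H ** (L ** J) ** T"
      by (simp only: XT) (simp only: X_def S_def matrix_mul_assoc)
    then show ?thesis by (simp add: J)
  qed
  have X1: "spectral_norm X \<le> 1"
  proof (rule spectral_norm_le)
    fix x :: "real^'d"
    have "(norm (X *v x))\<^sup>2 = (T *v (J *v x)) \<bullet> (T *v (J *v x))"
      by (simp add: X_def power2_norm_eq_inner matrix_vector_mul_assoc)
    also have "\<dots> = (J *v x) \<bullet> (\<Theta> *v (J *v x))"
      unfolding symmetric_mat_inner[OF psd_sym[OF T(1)]] T(2)[symmetric] by (simp add: matrix_vector_mul_assoc matrix_mul_assoc)
    also have "\<dots> \<le> (J *v x) \<bullet> (\<Theta>s *v (J *v x))"
      using \<Theta>(2) by (simp add: loewner_le_def psd_def matrix_vector_mult_diff_rdistrib inner_diff_right)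
    also have "\<dots> = (L *v (J *v x)) \<bullet> (L *v (J *v x))"
      unfolding symmetric_mat_inner[OF posdef_sym[OF L(1)]] L(2)[symmetric] by (simp add: matrix_vector_mul_assoc matrix_mul_assoc)
    also have "\<dots> = (norm x)\<^sup>2" by (simp add: matrix_vector_mul_assoc J power2_norm_eq_inner)
    finally show "norm (X *v x) \<le> 1 * norm x" using power2_le_imp_le by auto
  qed
  have s1: "spectral_norm S < 1" using dom(2) \<gamma> by linarith
  have Xd: "spectral_norm (X - mat 1) \<le> \<delta>" using \<delta> by (simp add: X_def T_def J_def L_def)
  note pert = ln_det_congruence_perturbation[OF dom(1) s1 X1 Xd, unfolded XSX]
  have THT: "symmetric_mat (T ** H ** T)"
    using symmetric_mat_congruence[OF Hsym, of T] by (simp add: T(3))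
  have pd: "posdef (mat 1 - T ** H ** T)" by (rule posdef_1_minus[OF THT pert(1)])
  have tr: "trace (T ** H ** T - S) = trace ((\<Theta> - \<Theta>s) ** H)"
  proof -
    have "trace (T ** H ** T) = trace (\<Theta> ** H)" unfolding T(2)[symmetric] by (metis matrix_mul_assoc trace_mul_sym)
    moreover have "trace S = trace (\<Theta>s ** H)" unfolding L(2)[symmetric] S_def by (metis matrix_mul_assoc trace_mul_sym)
    ultimately show ?thesis by (simp add: trace_sub matrix_mul_diff_left)
  qed
  define b where "b = H *v \<mu> + h"
  have quad: "(T *v b) \<bullet> (matrix_inv (mat 1 - T ** H ** T) *v (T *v b)) \<le> b \<bullet> (matrix_inv (matrix_inv \<Theta>s - H) *v b)"
  proof -
    define y where "y = matrix_inv (mat 1 - T ** H ** T) *v (T *v b)"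
    define x where "x = T *v y"
    have "(T *v b) \<bullet> (matrix_inv (mat 1 - T ** H ** T) *v (T *v b))
      = 2 * (y \<bullet> (T *v b)) - y \<bullet> ((mat 1 - T ** H ** T) *v y)"
      unfolding y_def by (rule posdef_inv_quad_eq[OF pd])
    also have "y \<bullet> (T *v b) = x \<bullet> b" by (simp add: x_def symmetric_mat_inner[OF psd_sym[OF T(1)]])
    also have "y \<bullet> ((mat 1 - T ** H ** T) *v y) = (norm y)\<^sup>2 - x \<bullet> (H *v x)"
      using inner_congruence_transpose[of y T H]
      by (simp add: matrix_vector_mult_diff_rdistrib inner_diff_right power2_norm_eq_inner x_def T(3))
    also have "2 * (x \<bullet> b) - ((norm y)\<^sup>2 - x \<bullet> (H *v x)) \<le> 2 * (x \<bullet> b) - x \<bullet> ((matrix_inv \<Theta>s - H) *v x)"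
    proof -
      \<comment> \<open>\<open>\<Theta>s\<^sup>-\<^sup>1\<^sup>/\<^sup>2 x = X\<^sup>T y\<close>, and \<open>X\<^sup>T\<close> is a contraction.\<close>
      have "x \<bullet> (matrix_inv \<Theta>s *v x) = (norm (transpose X *v y))\<^sup>2"
        using inner_congruence_transpose[of x J "mat 1"]
        by (simp add: \<Theta>sJ JT XT x_def power2_norm_eq_inner matrix_vector_mul_assoc del: transpose_matrix_vector)
      also have "\<dots> \<le> (norm y)\<^sup>2"
      proof (rule power_mono)
        have "norm (transpose X *v y) \<le> spectral_norm (transpose X) * norm y" by (rule norm_matrix_vector_le)
        also have "\<dots> \<le> 1 * norm y"
          using spectral_norm_transpose_le[of X] X1 by (intro mult_right_mono) auto
        finally show "norm (transpose X *v y) \<le> norm y" by simp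
      qed simp
      finally show ?thesis by (simp add: matrix_vector_mult_diff_rdistrib inner_diff_right)
    qed
    also have "\<dots> \<le> b \<bullet> (matrix_inv (matrix_inv \<Theta>s - H) *v b)"
      by (rule posdef_inv_quad_ge[OF dom(4)])
    finally show ?thesis .
  qed
  let ?c = "h \<bullet> \<mu> + (1/2) * (\<mu> \<bullet> (H *v \<mu>))"
  have expo: "h \<bullet> (\<mu> + T *v x) + (1/2) * ((\<mu> + T *v x) \<bullet> (H *v (\<mu> + T *v x)))
    = ?c + ((T *v b) \<bullet> x + (1/2) * (x \<bullet> ((T ** H ** T) *v x)))" for x
  proof -
    have "x \<bullet> ((T ** H ** T) *v x) = (T *v x) \<bullet> (H *v (T *v x))"
      using inner_congruence_transpose[of x T H] by (simp add: T(3))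
    moreover have "(T *v b) \<bullet> x = (H *v \<mu>) \<bullet> (T *v x) + h \<bullet> (T *v x)"
      by (simp add: symmetric_mat_inner[OF psd_sym[OF T(1)]] b_def inner_add_left)
    moreover have "\<mu> \<bullet> (H *v (T *v x)) = (H *v \<mu>) \<bullet> (T *v x)"
      by (simp add: symmetric_mat_inner[OF Hsym])
    ultimately show ?thesis
      by (simp add: matrix_vector_right_distrib inner_add_left inner_add_right inner_commute)
  qed
  have "(\<integral>\<^sup>+\<zeta>. ennreal (exp (h \<bullet> \<zeta> + (1/2) * (\<zeta> \<bullet> (H *v \<zeta>)))) \<partial>gaussian \<mu> \<Theta>)
    = (\<integral>\<^sup>+x. ennreal (exp (h \<bullet> (\<mu> + T *v x) + (1/2) * ((\<mu> + T *v x) \<bullet> (H *v (\<mu> + T *v x))))) \<partial>std_gaussian)"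
    unfolding gaussian_def T_def[symmetric] by (rule nn_integral_distr) measurable
  also have "\<dots> = (\<integral>\<^sup>+x. ennreal (exp ?c) * ennreal (exp ((T *v b) \<bullet> x + (1/2) * (x \<bullet> ((T ** H ** T) *v x)))) \<partial>std_gaussian)"
    unfolding expo exp_add[of ?c] by (simp add: ennreal_mult'[symmetric])
  also have "\<dots> = ennreal (exp ?c) * (\<integral>\<^sup>+x. ennreal (exp ((T *v b) \<bullet> x + (1/2) * (x \<bullet> ((T ** H ** T) *v x)))) \<partial>std_gaussian)"
    by (rule nn_integral_cmult) measurable
  also have "\<dots> = ennreal (exp (?c + ((1/2) * ((T *v b) \<bullet> (matrix_inv (mat 1 - T ** H ** T) *v (T *v b)))
      - (1/2) * ln (det (mat 1 - T ** H ** T)))))"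
    unfolding nn_integral_std_gaussian_exp_quad[OF THT pd] exp_add[of ?c] by (simp add: ennreal_mult'[symmetric])
  also have "\<dots> \<le> ennreal (exp (Phi \<Theta>s \<delta> h H \<Theta> (outer_square (vec_snoc \<mu> 1))))"
  proof -
    define r where "r = \<delta> * (2 + \<delta>) / (2 * (1 - spectral_norm S)) * (norm S)\<^sup>2"
    have "Phi \<Theta>s \<delta> h H \<Theta> (outer_square (vec_snoc \<mu> 1)) =
      - (1/2) * ln (det (mat 1 - S)) + (1/2) * trace ((\<Theta> - \<Theta>s) ** H)
      + r + (1/2) * (\<mu> \<bullet> (H *v \<mu>) + 2 * (h \<bullet> \<mu>) + b \<bullet> (matrix_inv (matrix_inv \<Theta>s - H) *v b))"
      unfolding Phi_def Let_def L_def[symmetric] S_def[symmetric] trace_outer_square frobenius_norm_eq_norm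
        matrix_vector_mult_add_rdistrib inner_add_right bordered_quad inner_congruence_transpose
        append_col_mult_vec
      by (simp add: b_def r_def)
    then show ?thesis using quad pert(2)[unfolded tr, folded r_def]
      by (intro ennreal_leI iffD2[OF exp_le_cancel_iff]) (simp add: add_divide_distrib)
  qed
  finally show ?thesis .
qed

section \<open>Large deviations of independent samples\<close>

text \<open>Chernoff's bound: the indicator of the event is dominated by the exponential of the scaled excess, whose expectation
  factorizes over the independent observations.\<close>

lemma iid_chernoff:
  fixes N :: "'a measure" and \<phi> :: "'a \<Rightarrow> real"
  assumes N: "prob_space N" and \<phi>[measurable]: "\<phi> \<in> borel_measurable N"
    and K: "1 \<le> K" and \<alpha>: "0 < \<alpha>"
    and mgf: "(\<integral>\<^sup>+x. ennreal (exp (\<phi> x / \<alpha>)) \<partial>N) \<le> ennreal (exp c)"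
  shows "measure (iid_sample K N) {\<zeta> \<in> space (iid_sample K N). s < (1 / real K) * (\<Sum>i<K. \<phi> (\<zeta> i))}
    \<le> exp (real K * (c - s / \<alpha>))"
proof -
  interpret N: prob_space N by (rule N)
  interpret product_sigma_finite "\<lambda>_::nat. N" ..
  let ?P = "iid_sample K N"
  let ?A = "{\<zeta> \<in> space ?P. s < (1 / real K) * (\<Sum>i<K. \<phi> (\<zeta> i))}"
  interpret P: prob_space ?P unfolding iid_sample_def by (rule prob_space_PiM) (rule N)
  have A[measurable]: "?A \<in> sets ?P" unfolding iid_sample_def by measurable
  let ?k = "exp (- (real K * s / \<alpha>))"
  have "emeasure ?P ?A = (\<integral>\<^sup>+\<zeta>. indicator ?A \<zeta> \<partial>?P)" by (rule nn_integral_indicator[OF A, symmetric])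
  also have "\<dots> \<le> (\<integral>\<^sup>+\<zeta>. ennreal ?k * (\<Prod>i<K. ennreal (exp (\<phi> (\<zeta> i) / \<alpha>))) \<partial>?P)"
  proof (rule nn_integral_mono)
    fix \<zeta>
    have "1 \<le> ?k * (\<Prod>i<K. exp (\<phi> (\<zeta> i) / \<alpha>))" if "\<zeta> \<in> ?A"
    proof -
      have "real K * s < (\<Sum>i<K. \<phi> (\<zeta> i))" using that K by (simp add: field_simps)
      then have "0 \<le> - (real K * s / \<alpha>) + (\<Sum>i<K. \<phi> (\<zeta> i) / \<alpha>)"
        using \<alpha> by (simp add: sum_divide_distrib[symmetric] divide_right_mono)
      then have "1 \<le> exp (- (real K * s / \<alpha>) + (\<Sum>i<K. \<phi> (\<zeta> i) / \<alpha>))" by simp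
      then show ?thesis by (simp only: exp_add exp_sum finite_lessThan)
    qed
    then show "indicator ?A \<zeta> \<le> ennreal ?k * (\<Prod>i<K. ennreal (exp (\<phi> (\<zeta> i) / \<alpha>)))"
      by (auto simp: indicator_def prod_ennreal ennreal_mult'[symmetric] prod_nonneg simp del: ennreal_1 simp: ennreal_1[symmetric])
  qed
  also have "\<dots> = ennreal ?k * (\<integral>\<^sup>+\<zeta>. (\<Prod>i<K. ennreal (exp (\<phi> (\<zeta> i) / \<alpha>))) \<partial>?P)"
    unfolding iid_sample_def by (rule nn_integral_cmult) measurable
  also have "\<dots> = ennreal ?k * (\<Prod>i<K. \<integral>\<^sup>+x. ennreal (exp (\<phi> x / \<alpha>)) \<partial>N)"
    unfolding iid_sample_def by (subst product_nn_integral_prod) auto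
  also have "\<dots> \<le> ennreal ?k * (\<Prod>i<K. ennreal (exp c))"
    by (intro mult_left_mono prod_mono_ennreal) (auto intro: mgf)
  also have "\<dots> = ennreal (exp (real K * (c - s / \<alpha>)))"
  proof -
    have "?k * exp c ^ K = exp (real K * (c - s / \<alpha>))"
      by (simp add: exp_of_nat_mult[symmetric] exp_add[symmetric] algebra_simps)
    then show ?thesis by (simp add: ennreal_power ennreal_mult'[symmetric])
  qed
  finally show ?thesis unfolding P.emeasure_eq_measure by simp
qed

section \<open>Admissible scalings\<close>

text \<open>A quantitative form of positive definiteness; it shows that \<open>\<gamma> \<alpha> \<Theta>s\<^sup>-\<^sup>1\<close> dominates any given symmetric matrix for
  large \<open>\<alpha>\<close>.\<close>

lemma posdef_quad_ge_norm:
  fixes \<Theta> :: "real^'d^'d"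
  assumes \<Theta>: "posdef \<Theta>"
  obtains c where "0 \<le> c" "\<And>x. x \<bullet> x \<le> c * (x \<bullet> (\<Theta> *v x))"
proof
  let ?J = "matrix_inv (psd_sqrt \<Theta>)"
  have L: "posdef (psd_sqrt \<Theta>)" by (rule posdef_psd_sqrt[OF \<Theta>])
  show "0 \<le> (spectral_norm ?J)\<^sup>2" by simp
  fix x :: "real^'d"
  have "norm x = norm (?J *v (psd_sqrt \<Theta> *v x))"
    by (simp add: matrix_inv_mult_vec posdef_invertible L)
  also have "\<dots> \<le> spectral_norm ?J * norm (psd_sqrt \<Theta> *v x)" by (rule norm_matrix_vector_le)
  finally have "(norm x)\<^sup>2 \<le> (spectral_norm ?J * norm (psd_sqrt \<Theta> *v x))\<^sup>2" by (intro power_mono) auto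
  also have "\<dots> = (spectral_norm ?J)\<^sup>2 * ((psd_sqrt \<Theta> *v x) \<bullet> (psd_sqrt \<Theta> *v x))"
    by (simp add: power_mult_distrib power2_norm_eq_inner)
  also have "(psd_sqrt \<Theta> *v x) \<bullet> (psd_sqrt \<Theta> *v x) = x \<bullet> (\<Theta> *v x)"
    using psd_sqrt(2)[OF posdef_psd[OF \<Theta>]]
    by (simp add: symmetric_mat_inner[OF posdef_sym[OF L]] matrix_vector_mul_assoc)
  finally show "x \<bullet> x \<le> (spectral_norm ?J)\<^sup>2 * (x \<bullet> (\<Theta> *v x))" by (simp add: power2_norm_eq_inner)
qed

lemma Phi_dom_scaleR:
  fixes \<Theta> :: "real^'d^'d"
  assumes "posdef \<Theta>" "0 < \<alpha>"
  shows "Phi_dom (\<gamma> * \<alpha>) \<Theta> H \<longleftrightarrow> Phi_dom \<gamma> \<Theta> (H /\<^sub>R \<alpha>)"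
proof -
  have s: "symmetric_mat (H /\<^sub>R \<alpha>) \<longleftrightarrow> symmetric_mat H"
    using assms(2) symmetric_mat_scaleR[of H "inverse \<alpha>"] symmetric_mat_scaleR[of "H /\<^sub>R \<alpha>" \<alpha>] by auto
  have "\<bar>x \<bullet> (H *v x)\<bar> / \<alpha> = \<bar>x \<bullet> ((H /\<^sub>R \<alpha>) *v x)\<bar>" for x
    using assms(2) by (simp add: scaleR_matrix_vector abs_mult divide_inverse mult.commute)
  then have "\<bar>x \<bullet> (H *v x)\<bar> \<le> \<gamma> * \<alpha> * c \<longleftrightarrow> \<bar>x \<bullet> ((H /\<^sub>R \<alpha>) *v x)\<bar> \<le> \<gamma> * c" for x c
    using assms(2) by (metis mult.assoc mult.commute pos_divide_le_eq)
  then show ?thesis unfolding Phi_dom_iff[OF assms(1)] s by simp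
qed

lemma Phi_dom_uminus:
  fixes \<Theta> :: "real^'d^'d"
  assumes "posdef \<Theta>"
  shows "Phi_dom \<gamma> \<Theta> (- H) \<longleftrightarrow> Phi_dom \<gamma> \<Theta> H"
  using symmetric_mat_uminus[of H] symmetric_mat_uminus[of "- H"]
  unfolding Phi_dom_iff[OF assms] by (auto simp: matrix_vector_mult_uminus)

lemma Phi_dom_add:
  fixes \<Theta> :: "real^'d^'d"
  assumes "posdef \<Theta>" "Phi_dom c \<Theta> H" "Phi_dom d \<Theta> I" and uv: "0 \<le> u" "0 \<le> v"
  shows "Phi_dom (u * c + v * d) \<Theta> (u *\<^sub>R H + v *\<^sub>R I)"
proof -
  have "\<bar>x \<bullet> ((u *\<^sub>R H + v *\<^sub>R I) *v x)\<bar> \<le> (u * c + v * d) * (x \<bullet> (matrix_inv \<Theta> *v x))" for x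
  proof -
    have "\<bar>x \<bullet> ((u *\<^sub>R H + v *\<^sub>R I) *v x)\<bar> \<le> u * \<bar>x \<bullet> (H *v x)\<bar> + v * \<bar>x \<bullet> (I *v x)\<bar>"
      using abs_triangle_ineq[of "u * (x \<bullet> (H *v x))" "v * (x \<bullet> (I *v x))"] uv
      by (simp add: matrix_vector_mult_add_rdistrib scaleR_matrix_vector inner_add_right abs_mult)
    also have "\<dots> \<le> u * (c * (x \<bullet> (matrix_inv \<Theta> *v x))) + v * (d * (x \<bullet> (matrix_inv \<Theta> *v x)))"
      using assms by (intro add_mono mult_left_mono) (auto simp: Phi_dom_iff)
    finally show ?thesis by (simp add: algebra_simps)
  qed
  then show ?thesis using assms by (auto simp: Phi_dom_iff symmetric_mat_add symmetric_mat_scaleR)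
qed

lemma admissible_eq: "admissible \<gamma> \<Theta> H = {\<alpha>. 0 < \<alpha> \<and> Phi_dom (\<gamma> * \<alpha>) \<Theta> H}"
  by (simp add: admissible_def Phi_dom_def)

lemma admissible_nonempty:
  fixes \<Theta> H :: "real^'d^'d"
  assumes \<Theta>: "posdef \<Theta>" and \<gamma>: "0 < \<gamma>" and H: "symmetric_mat H"
  shows "admissible \<gamma> \<Theta> H \<noteq> {}"
proof -
  obtain c where c: "0 \<le> c" "\<And>x. x \<bullet> x \<le> c * (x \<bullet> (matrix_inv \<Theta> *v x))"
    using posdef_quad_ge_norm[OF posdef_matrix_inv[OF \<Theta>]] by blast
  define \<alpha> where "\<alpha> = (spectral_norm H * c + 1) / \<gamma>"
  have \<alpha>: "0 < \<alpha>" "\<gamma> * \<alpha> = spectral_norm H * c + 1"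
    using \<gamma> c spectral_norm_nonneg[of H] by (simp_all add: \<alpha>_def add_nonneg_pos)
  have "\<bar>x \<bullet> (H *v x)\<bar> \<le> \<gamma> * \<alpha> * (x \<bullet> (matrix_inv \<Theta> *v x))" for x
  proof -
    have "\<bar>x \<bullet> (H *v x)\<bar> \<le> norm x * norm (H *v x)" by (rule Cauchy_Schwarz_ineq2)
    also have "\<dots> \<le> norm x * (spectral_norm H * norm x)"
      by (intro mult_left_mono norm_matrix_vector_le norm_ge_zero)
    also have "\<dots> = spectral_norm H * (x \<bullet> x)" by (simp add: power2_norm_eq_inner[symmetric] power2_eq_square)
    also have "\<dots> \<le> spectral_norm H * (c * (x \<bullet> (matrix_inv \<Theta> *v x)))"
      by (intro mult_left_mono c spectral_norm_nonneg)
    also have "\<dots> \<le> \<gamma> * \<alpha> * (x \<bullet> (matrix_inv \<Theta> *v x))"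
      using posdef_psd[OF posdef_matrix_inv[OF \<Theta>]] unfolding \<alpha>(2)
      by (simp add: psd_def algebra_simps)
    finally show ?thesis .
  qed
  then have "\<alpha> \<in> admissible \<gamma> \<Theta> H" using \<alpha>(1) H by (simp add: admissible_eq Phi_dom_iff[OF \<Theta>])
  then show ?thesis by blast
qed

section \<open>Convexity and linear minorant of \<open>Phi\<close>\<close>

text \<open>The function \<open>x\<^sup>2 / y\<close> is jointly convex, increasing in \<open>x \<ge> 0\<close> and decreasing in \<open>y > 0\<close>. Hence it may be composed
  with the convex Frobenius norm and the concave function one minus spectral norm.\<close>

lemma square_over_linear_convex:
  fixes m n :: real
  assumes st: "0 < s" "0 < t" and uv: "0 \<le> u" "0 \<le> v" "u + v = 1"
    and x: "0 \<le> x" "x \<le> u * m + v * n" and y: "u * s + v * t \<le> y"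
  shows "x\<^sup>2 / y \<le> u * (m\<^sup>2 / s) + v * (n\<^sup>2 / t)"
proof -
  have pos: "0 < u * s + v * t"
  proof (cases "u = 0")
    case False
    then have "0 < u * s" "0 \<le> v * t" using st uv by auto
    then show ?thesis by linarith
  qed (use st uv in auto)
  have y0: "0 < y" using pos y by linarith
  \<comment> \<open>The slope at which the minorant \<open>2 a p - a\<^sup>2 r\<close> of \<open>p\<^sup>2 / r\<close> touches at \<open>(x, y)\<close>.\<close>
  define a where "a = x / y"
  have le: "2 * a * p - a\<^sup>2 * r \<le> p\<^sup>2 / r" if "0 < r" for p r
  proof -
    have "p\<^sup>2 / r - (2 * a * p - a\<^sup>2 * r) = (p - a * r)\<^sup>2 / r"
      using that by (simp add: field_simps power2_eq_square)
    also have "\<dots> \<ge> 0" using that by simp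
    finally show ?thesis by linarith
  qed
  have a0: "0 \<le> a" using x y0 by (simp add: a_def)
  have "x\<^sup>2 / y = 2 * a * x - a\<^sup>2 * y" using y0 by (simp add: a_def field_simps power2_eq_square)
  also have "\<dots> \<le> 2 * a * (u * m + v * n) - a\<^sup>2 * (u * s + v * t)"
    using x y a0 by (intro diff_mono mult_left_mono) auto
  also have "\<dots> = u * (2 * a * m - a\<^sup>2 * s) + v * (2 * a * n - a\<^sup>2 * t)" by (simp add: algebra_simps)
  also have "\<dots> \<le> u * (m\<^sup>2 / s) + v * (n\<^sup>2 / t)" by (intro add_mono mult_left_mono le st uv)
  finally show ?thesis .
qed

lemma append_col_linear:
  "append_col (u *\<^sub>R H + v *\<^sub>R I) (u *\<^sub>R h + v *\<^sub>R i) = u *\<^sub>R append_col H h + v *\<^sub>R append_col I i"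
  by (auto simp: append_col_def vec_snoc_def vec_eq_iff split: sum.split)

lemma bordered_linear:
  "bordered (u *\<^sub>R H + v *\<^sub>R I) (u *\<^sub>R h + v *\<^sub>R i) = u *\<^sub>R bordered H h + v *\<^sub>R bordered I i"
  unfolding bordered_def append_col_linear
  by (auto simp: append_row_def append_col_def vec_snoc_def vec_eq_iff split: sum.split)

lemma trace_psd_mult:
  fixes W :: "real^'n^'n"
  assumes "psd W"
  shows "trace (W ** X) = (\<Sum>i\<in>UNIV. row i (psd_sqrt W) \<bullet> (X *v row i (psd_sqrt W)))"
  using trace_gram[OF psd_sym[OF psd_sqrt(1)[OF assms]], of X] psd_sqrt(2)[OF assms] by simp

text \<open>The summands are treated one by one: \<open>- ln det\<close> of an affine function; a linear term; the square of the Frobenius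
  norm over a positive concave function; and, since \<open>W\<close> is positive semidefinite, a sum of values
  \<open>x \<bullet> T x\<close> in which the inverse enters only through the jointly convex form \<open>b \<bullet> P\<^sup>-\<^sup>1 b\<close>.\<close>

theorem Phi_convex:
  fixes \<Theta>s \<Theta> H1 H2 :: "real^'d^'d"
  assumes \<Theta>s: "posdef \<Theta>s" and W: "psd W" and \<delta>: "0 \<le> \<delta>" and \<gamma>: "\<gamma> < 1"
    and H1: "Phi_dom \<gamma> \<Theta>s H1" and H2: "Phi_dom \<gamma> \<Theta>s H2"
    and uv: "0 \<le> u" "0 \<le> v" "u + v = 1"
  shows "Phi \<Theta>s \<delta> (u *\<^sub>R h1 + v *\<^sub>R h2) (u *\<^sub>R H1 + v *\<^sub>R H2) \<Theta> W
    \<le> u * Phi \<Theta>s \<delta> h1 H1 \<Theta> W + v * Phi \<Theta>s \<delta> h2 H2 \<Theta> W"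
proof -
  define S where "S H = psd_sqrt \<Theta>s ** H ** psd_sqrt \<Theta>s" for H
  let ?h = "u *\<^sub>R h1 + v *\<^sub>R h2" and ?H = "u *\<^sub>R H1 + v *\<^sub>R H2"
  have Slin: "S ?H = u *\<^sub>R S H1 + v *\<^sub>R S H2"
    by (simp add: S_def matrix_add_ldistrib matrix_mul_add_left matrix_mul_scaleR_left matrix_mul_scaleR_right)
  note d1 = Phi_dom_scaled[OF \<Theta>s H1 \<gamma>, folded S_def]
  note d2 = Phi_dom_scaled[OF \<Theta>s H2 \<gamma>, folded S_def]
  have one: "u *\<^sub>R X + v *\<^sub>R X = X" for X :: "real^'d^'d"
    by (metis scaleR_add_left scaleR_one uv(3))
  have "mat 1 - S ?H = u *\<^sub>R (mat 1 - S H1) + v *\<^sub>R (mat 1 - S H2)"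
    using one[of "mat 1"] unfolding Slin by (simp add: algebra_simps)
  then have 1: "- (1/2) * ln (det (mat 1 - S ?H)) \<le> u * (- (1/2) * ln (det (mat 1 - S H1))) + v * (- (1/2) * ln (det (mat 1 - S H2)))"
    using ln_det_concave[OF d1(3) d2(3) uv] by simp
  have 2: "(1/2) * trace ((\<Theta> - \<Theta>s) ** ?H) = u * ((1/2) * trace ((\<Theta> - \<Theta>s) ** H1)) + v * ((1/2) * trace ((\<Theta> - \<Theta>s) ** H2))"
    by (simp add: matrix_add_ldistrib matrix_mul_scaleR_right trace_add trace_scaleR)
  have 3: "\<delta> * (2 + \<delta>) / (2 * (1 - spectral_norm (S ?H))) * (norm (S ?H))\<^sup>2
    \<le> u * (\<delta> * (2 + \<delta>) / (2 * (1 - spectral_norm (S H1))) * (norm (S H1))\<^sup>2)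
      + v * (\<delta> * (2 + \<delta>) / (2 * (1 - spectral_norm (S H2))) * (norm (S H2))\<^sup>2)"
  proof -
    have "(norm (S ?H))\<^sup>2 / (1 - spectral_norm (S ?H))
      \<le> u * ((norm (S H1))\<^sup>2 / (1 - spectral_norm (S H1))) + v * ((norm (S H2))\<^sup>2 / (1 - spectral_norm (S H2)))"
    proof (rule square_over_linear_convex)
      show "norm (S ?H) \<le> u * norm (S H1) + v * norm (S H2)"
        unfolding Slin using norm_triangle_ineq[of "u *\<^sub>R S H1" "v *\<^sub>R S H2"] uv by simp
      have "spectral_norm (S ?H) \<le> u * spectral_norm (S H1) + v * spectral_norm (S H2)"
        unfolding Slin by (rule spectral_norm_convex[OF uv(1,2)])
      then show "u * (1 - spectral_norm (S H1)) + v * (1 - spectral_norm (S H2)) \<le> 1 - spectral_norm (S ?H)"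
        using uv(3) by (simp add: algebra_simps)
    qed (use d1(2) d2(2) \<gamma> uv in auto)
    then have "(\<delta> * (2 + \<delta>) / 2) * ((norm (S ?H))\<^sup>2 / (1 - spectral_norm (S ?H)))
      \<le> (\<delta> * (2 + \<delta>) / 2) * (u * ((norm (S H1))\<^sup>2 / (1 - spectral_norm (S H1))) + v * ((norm (S H2))\<^sup>2 / (1 - spectral_norm (S H2))))"
      using \<delta> by (intro mult_left_mono) auto
    moreover have "\<delta> * (2 + \<delta>) / (2 * (1 - s)) * n = (\<delta> * (2 + \<delta>) / 2) * (n / (1 - s))" for s n :: real
      by simp
    ultimately show ?thesis by (simp only: distrib_left mult.left_commute)
  qed
  define T where "T h H = bordered H h + transpose (append_col H h) ** matrix_inv (matrix_inv \<Theta>s - H) ** append_col H h" for h and H :: "real^'d^'d"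
  have 4: "trace (W ** T ?h ?H) \<le> u * trace (W ** T h1 H1) + v * trace (W ** T h2 H2)"
  proof -
    have "x \<bullet> (T ?h ?H *v x) \<le> u * (x \<bullet> (T h1 H1 *v x)) + v * (x \<bullet> (T h2 H2 *v x))" for x
    proof -
      have P: "matrix_inv \<Theta>s - ?H = u *\<^sub>R (matrix_inv \<Theta>s - H1) + v *\<^sub>R (matrix_inv \<Theta>s - H2)"
        using one[of "matrix_inv \<Theta>s"] by (simp add: algebra_simps)
      have "append_col ?H ?h *v x = u *\<^sub>R (append_col H1 h1 *v x) + v *\<^sub>R (append_col H2 h2 *v x)"
        by (simp add: append_col_linear matrix_vector_mult_add_rdistrib scaleR_matrix_vector)
      moreover have "x \<bullet> (bordered ?H ?h *v x) = u * (x \<bullet> (bordered H1 h1 *v x)) + v * (x \<bullet> (bordered H2 h2 *v x))"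
        by (simp add: bordered_linear matrix_vector_mult_add_rdistrib scaleR_matrix_vector inner_add_right)
      ultimately show ?thesis
        using posdef_inv_quad_convex[OF d1(4) d2(4) uv, of "append_col H1 h1 *v x" "append_col H2 h2 *v x"]
        unfolding T_def matrix_vector_mult_add_rdistrib inner_add_right inner_congruence_transpose P
        by (simp add: distrib_left)
    qed
    then show ?thesis unfolding trace_psd_mult[OF W] sum_distrib_left sum.distrib[symmetric]
      by (intro sum_mono)
  qed
  have Phi: "Phi \<Theta>s \<delta> h H \<Theta> W = - (1/2) * ln (det (mat 1 - S H)) + (1/2) * trace ((\<Theta> - \<Theta>s) ** H)
     + \<delta> * (2 + \<delta>) / (2 * (1 - spectral_norm (S H))) * (norm (S H))\<^sup>2 + (1/2) * trace (W ** T h H)" for h H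
    by (simp only: Phi_def Let_def S_def T_def frobenius_norm_eq_norm)
  have comb: "a + b + c + (1/2) * d \<le> u * (a1 + b1 + c1 + (1/2) * e1) + v * (a2 + b2 + c2 + (1/2) * e2)"
    if "a \<le> u * a1 + v * a2" "b = u * b1 + v * b2" "c \<le> u * c1 + v * c2" "d \<le> u * e1 + v * e2"
    for a b c d a1 b1 c1 e1 a2 b2 c2 e2 :: real
    using that by (simp add: distrib_left)
  show ?thesis unfolding Phi by (rule comb[OF 1 2 3 4])
qed

text \<open>The derivative of \<open>Phi\<close> at \<open>(h, H) = (0, 0)\<close>, where \<open>Phi\<close> itself vanishes.\<close>

definition Phi_linear_part ::
  "real^'d^'d \<Rightarrow> real^'d \<Rightarrow> real^'d^'d \<Rightarrow> real^'d^'d \<Rightarrow> real^('d::finite + unit)^('d::finite + unit) \<Rightarrow> real" where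
  "Phi_linear_part \<Theta>s h H \<Theta> W =
    (1/2) * trace (psd_sqrt \<Theta>s ** H ** psd_sqrt \<Theta>s) + (1/2) * trace ((\<Theta> - \<Theta>s) ** H) + (1/2) * trace (W ** bordered H h)"

text \<open>Homogeneity makes the perspective \<open>\<alpha> l (h / \<alpha>, H / \<alpha>)\<close> of the linear part \<open>l\<close> independent of \<open>\<alpha>\<close>, which turns the
  lower bound for \<open>Phi\<close> into a lower bound for the objective that is uniform in \<open>\<alpha>\<close>.\<close>

lemma Phi_linear_part_scaleR:
  "Phi_linear_part \<Theta>s (c *\<^sub>R h) (c *\<^sub>R H) \<Theta> W = c * Phi_linear_part \<Theta>s h H \<Theta> W"
  using bordered_linear[of c H 0 0 h 0]
  by (simp add: Phi_linear_part_def matrix_mul_scaleR_left matrix_mul_scaleR_right trace_scaleR distrib_left)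

theorem Phi_ge_linear_part:
  fixes \<Theta>s \<Theta> H :: "real^'d^'d"
  assumes \<Theta>s: "posdef \<Theta>s" and W: "psd W" and \<delta>: "0 \<le> \<delta>" and \<gamma>: "\<gamma> < 1"
    and H: "Phi_dom \<gamma> \<Theta>s H"
  shows "Phi_linear_part \<Theta>s h H \<Theta> W \<le> Phi \<Theta>s \<delta> h H \<Theta> W"
proof -
  define S where "S = psd_sqrt \<Theta>s ** H ** psd_sqrt \<Theta>s"
  note d = Phi_dom_scaled[OF \<Theta>s H \<gamma>, folded S_def]
  define N where "N = transpose (append_col H h) ** matrix_inv (matrix_inv \<Theta>s - H) ** append_col H h"
  have 1: "ln (det (mat 1 - S)) \<le> - trace S"
    using posdef_ln_det_le_trace(2)[OF d(3)] by (simp add: trace_sub trace_I)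
  have 3: "0 \<le> \<delta> * (2 + \<delta>) / (2 * (1 - spectral_norm S)) * (norm S)\<^sup>2"
    using \<delta> d(2) \<gamma> by (intro mult_nonneg_nonneg divide_nonneg_nonneg) auto
  have 4: "0 \<le> trace (W ** N)"
    unfolding trace_psd_mult[OF W] N_def inner_congruence_transpose
    using posdef_psd[OF posdef_matrix_inv[OF d(4)]] by (intro sum_nonneg) (simp add: psd_def)
  have "Phi \<Theta>s \<delta> h H \<Theta> W = - (1/2) * ln (det (mat 1 - S)) + (1/2) * trace ((\<Theta> - \<Theta>s) ** H)
     + \<delta> * (2 + \<delta>) / (2 * (1 - spectral_norm S)) * (norm S)\<^sup>2 + (1/2) * (trace (W ** bordered H h) + trace (W ** N))"
    by (simp only: Phi_def Let_def S_def N_def frobenius_norm_eq_norm matrix_add_ldistrib trace_add)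
  with 1 3 4 show ?thesis unfolding Phi_linear_part_def S_def[symmetric] by argo
qed

lemma continuous_on_trace [continuous_intros]:
  fixes f :: "'a::topological_space \<Rightarrow> real^'n^'n"
  assumes "continuous_on S f"
  shows "continuous_on S (\<lambda>x. trace (f x))"
  unfolding trace_def using assms by (intro continuous_intros) auto

lemma continuous_on_matrix_mult [continuous_intros]:
  fixes f :: "'a::topological_space \<Rightarrow> real^'n^'m" and g :: "'a \<Rightarrow> real^'p^'n"
  assumes "continuous_on S f" "continuous_on S g"
  shows "continuous_on S (\<lambda>x. f x ** g x)"
  unfolding matrix_matrix_mult_def using assms by (intro continuous_intros) auto

lemma affine_map_continuous_on:
  fixes f :: "'a::euclidean_space \<Rightarrow> 'b::real_normed_vector"
  assumes "affine_map f"
  shows "continuous_on S f"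
proof -
  obtain L c where "linear L" "f = (\<lambda>x. L x + c)" using assms by (auto simp: affine_map_def)
  moreover from \<open>linear L\<close> have "continuous_on S L"
    by (simp add: linear_continuous_on linear_conv_bounded_linear)
  ultimately show ?thesis by (simp add: continuous_on_add)
qed

section \<open>Maxima of infima\<close>

text \<open>Let \<open>g\<close> be the inner infimum. If \<open>g\<close> had no maximizer, the relatively open sets on which \<open>f p t < g p'\<close> for some
  \<open>t\<close> would cover \<open>S\<close> as \<open>p'\<close> varies. Among the finitely many \<open>p'\<close> of a subcover, one with maximal \<open>g p'\<close> would then
  satisfy \<open>f p' t < g p'\<close> for some \<open>t\<close>.\<close>

lemma max_inf_proper_compact:
  fixes f :: "'a::topological_space \<Rightarrow> 'b \<Rightarrow> real"
  assumes S: "compact S" "S \<noteq> {}" and T: "T \<noteq> {}"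
    and cont: "\<And>t. t \<in> T \<Longrightarrow> continuous_on S (\<lambda>p. f p t)"
    and bdd: "\<And>p. p \<in> S \<Longrightarrow> bdd_below (f p ` T)"
  shows "max_inf_proper S T f"
proof -
  define g where "g p = (INF t\<in>T. f p t)" for p
  have "\<exists>p\<in>S. \<forall>p'\<in>S. g p' \<le> g p"
  proof (rule ccontr)
    assume "\<not> ?thesis"
    then have ex: "\<exists>p'\<in>S. g p < g p'" if "p \<in> S" for p using that by (meson not_le)
    have "\<exists>A. open A \<and> A \<inter> S = (\<lambda>p. f p t) -` {..<c} \<inter> S" if "t \<in> T" for t c
      using cont[OF that] unfolding continuous_on_open_invariant by (meson open_lessThan)
    then obtain A where A: "\<And>t c. t \<in> T \<Longrightarrow> open (A t c)"
      "\<And>t c. t \<in> T \<Longrightarrow> A t c \<inter> S = (\<lambda>p. f p t) -` {..<c} \<inter> S" by metis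
    have cover: "S \<subseteq> (\<Union>x\<in>T \<times> S. A (fst x) (g (snd x)))"
    proof
      fix p assume p: "p \<in> S"
      obtain p' where p': "p' \<in> S" "g p < g p'" using ex[OF p] by blast
      then obtain t where "t \<in> T" "f p t < g p'"
        unfolding g_def[of p] using cINF_less_iff[OF T bdd[OF p]] by blast
      then show "p \<in> (\<Union>x\<in>T \<times> S. A (fst x) (g (snd x)))"
        using A(2)[of t "g p'"] p p' by (intro UN_I[of "(t, p')"]) auto
    qed
    have op: "open (A (fst x) (g (snd x)))" if "x \<in> T \<times> S" for x using that A(1) by auto
    obtain C where C: "C \<subseteq> T \<times> S" "finite C" "S \<subseteq> (\<Union>x\<in>C. A (fst x) (g (snd x)))"
      by (rule compactE_image[OF S(1) op cover])
    have "C \<noteq> {}" using C(3) S(2) by auto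
    then obtain x where x: "x \<in> C" "\<And>y. y \<in> C \<Longrightarrow> g (snd y) \<le> g (snd x)"
      using C(2) Max_in[of "(\<lambda>x. g (snd x)) ` C"] Max_ge[of "(\<lambda>x. g (snd x)) ` C"] by fastforce
    have sx: "snd x \<in> S" using x C(1) by auto
    then obtain y where y: "y \<in> C" "snd x \<in> A (fst y) (g (snd y))" using C(3) by blast
    have ty: "fst y \<in> T" using y C(1) by auto
    have "f (snd x) (fst y) < g (snd y)" using A(2)[OF ty] y(2) sx by auto
    also have "\<dots> \<le> g (snd x)" by (rule x(2)[OF y(1)])
    also have "\<dots> \<le> f (snd x) (fst y)" unfolding g_def by (rule cINF_lower[OF bdd[OF sx] ty])
    finally show False by simp
  qed
  then obtain p where p: "p \<in> S" "\<And>p'. p' \<in> S \<Longrightarrow> g p' \<le> g p" by blast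
  have "max_inf S T f = g p"
    unfolding max_inf_def g_def[symmetric] using p by (intro cSup_eq_maximum) auto
  then show ?thesis unfolding max_inf_proper_def g_def[symmetric] using T bdd p
    by (intro conjI ballI bexI[of _ p]) auto
qed

lemma max_inf_upper:
  assumes "max_inf_proper S T f" "p \<in> S"
  shows "(INF t\<in>T. f p t) \<le> max_inf S T f"
  using assms unfolding max_inf_proper_def by metis

lemma max_inf_less_witness:
  assumes "max_inf_proper S T f" "p \<in> S" "max_inf S T f < c"
  obtains t where "t \<in> T" "f p t < c"
proof -
  have "(INF t\<in>T. f p t) < c" using max_inf_upper[OF assms(1,2)] assms(3) by linarith
  moreover have "T \<noteq> {}" "bdd_below (f p ` T)" using assms(1,2) by (auto simp: max_inf_proper_def)
  ultimately have "\<exists>t\<in>T. f p t < c" by (simp add: cINF_less_iff)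
  then show ?thesis using that by blast
qed

text \<open>Partial minimization of a jointly convex function, followed by a supremum, gives a convex function. The minimization
  variable may range over a set depending on \<open>x\<close>; it is enough that the value at some point of the set belonging to the
  combination is below the combination of the values.\<close>

lemma convex_on_max_inf:
  fixes f :: "'x::real_vector \<Rightarrow> 'a \<Rightarrow> 'b \<Rightarrow> real"
  assumes X: "convex X" and proper: "\<And>x. x \<in> X \<Longrightarrow> max_inf_proper S (T x) (f x)"
    and joint: "\<And>x y s t u v p. \<lbrakk>x \<in> X; y \<in> X; p \<in> S; s \<in> T x; t \<in> T y; 0 \<le> u; 0 \<le> v; u + v = 1\<rbrakk>
      \<Longrightarrow> \<exists>r\<in>T (u *\<^sub>R x + v *\<^sub>R y). f (u *\<^sub>R x + v *\<^sub>R y) p r \<le> u * f x p s + v * f y p t"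
  shows "convex_on X (\<lambda>x. max_inf S (T x) (f x))"
  unfolding convex_on_def
proof (intro conjI ballI allI impI X)
  fix x y and u v :: real
  assume x: "x \<in> X" and y: "y \<in> X" and uv: "0 \<le> u" "0 \<le> v" "u + v = 1"
  let ?z = "u *\<^sub>R x + v *\<^sub>R y"
  have z: "?z \<in> X" using X x y uv by (simp add: convexD)
  obtain p where p: "p \<in> S" "max_inf S (T ?z) (f ?z) = (INF t\<in>T ?z. f ?z p t)"
    and bdd: "bdd_below (f ?z p ` T ?z)"
    using proper[OF z] unfolding max_inf_proper_def by blast
  show "max_inf S (T ?z) (f ?z) \<le> u * max_inf S (T x) (f x) + v * max_inf S (T y) (f y)"
  proof (rule field_le_epsilon)
    fix e :: real assume e: "0 < e"
    obtain s where s: "s \<in> T x" "f x p s < max_inf S (T x) (f x) + e"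
      using max_inf_less_witness[OF proper[OF x] p(1), of "max_inf S (T x) (f x) + e"] e by auto
    obtain t where t: "t \<in> T y" "f y p t < max_inf S (T y) (f y) + e"
      using max_inf_less_witness[OF proper[OF y] p(1), of "max_inf S (T y) (f y) + e"] e by auto
    obtain r where r: "r \<in> T ?z" "f ?z p r \<le> u * f x p s + v * f y p t"
      using joint[OF x y p(1) s(1) t(1) uv] by blast
    have "max_inf S (T ?z) (f ?z) \<le> f ?z p r" unfolding p(2) by (rule cINF_lower[OF bdd r(1)])
    also have "\<dots> \<le> u * f x p s + v * f y p t" by (rule r(2))
    also have "\<dots> \<le> u * (max_inf S (T x) (f x) + e) + v * (max_inf S (T y) (f y) + e)"
      using s(2) t(2) uv by (intro add_mono mult_left_mono) auto
    also have "\<dots> = u * max_inf S (T x) (f x) + v * max_inf S (T y) (f y) + (u + v) * e"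
      by (simp add: algebra_simps)
    finally show "max_inf S (T ?z) (f ?z) \<le> u * max_inf S (T x) (f x) + v * max_inf S (T y) (f y) + e"
      using uv by simp
  qed
qed

section \<open>Symmetry under negation\<close>

lemma G_fun_uminus: "G_fun (- Q) (- q) v Z = - G_fun Q q v Z"
proof -
  have "(- Q) ** Z = - (Q ** Z)" by (simp add: matrix_eq matrix_vector_mul_assoc[symmetric] matrix_vector_mult_uminus)
  then show ?thesis by (simp add: G_fun_def trace_uminus)
qed

lemma F_fun_uminus: "F_fun (- Q) (- q) u v = - F_fun Q q u v"
  by (simp add: F_fun_def matrix_vector_mult_uminus)

lemma G_fun_outer_square: "G_fun Q q v (outer_square (vec_snoc u 1)) = F_fun Q q u v"
  unfolding G_fun_def F_fun_def trace_mul_sym[of Q] trace_outer_square ..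

text \<open>The lower deviation of an estimate of \<open>F\<close> is the upper deviation of the negated estimate of \<open>- F\<close>.\<close>

lemma obj_minus_eq_obj_plus:
  "obj_minus K \<epsilon> \<Theta>s \<delta> M A Q q h H = obj_plus K \<epsilon> \<Theta>s \<delta> M A (- Q) (- q) (- h) (- H)"
  by (auto simp: obj_minus_def obj_plus_def Let_def G_fun_uminus fun_eq_iff)

lemma admissible_uminus: "posdef \<Theta> \<Longrightarrow> admissible \<gamma> \<Theta> (- H) = admissible \<gamma> \<Theta> H"
  by (simp add: admissible_eq Phi_dom_uminus)

lemma Psi_minus_eq_Psi_plus:
  "posdef \<Theta>s \<Longrightarrow> Psi_minus K \<epsilon> \<gamma> \<Theta>s \<delta> V \<Z> M A Q q h H = Psi_plus K \<epsilon> \<gamma> \<Theta>s \<delta> V \<Z> M A (- Q) (- q) (- h) (- H)"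
  by (simp add: Psi_minus_def Psi_plus_def obj_minus_eq_obj_plus admissible_uminus)

lemma convex_symmetric_mat: "convex {H :: real^'n^'n. symmetric_mat H}"
  by (auto simp: convex_def symmetric_mat_add symmetric_mat_scaleR)

lemma convex_on_compose_uminus:
  assumes "convex_on X f" and "\<And>x. x \<in> X \<Longrightarrow> - x \<in> X"
  shows "convex_on X (\<lambda>x. f (- x))"
  unfolding convex_on_def
proof (intro conjI ballI allI impI)
  show "convex X" using assms(1) by (simp add: convex_on_def)
  fix x y and u v :: real
  assume *: "x \<in> X" "y \<in> X" "0 \<le> u" "0 \<le> v" "u + v = 1"
  then have "f (u *\<^sub>R (- x) + v *\<^sub>R (- y)) \<le> u * f (- x) + v * f (- y)"
    using assms unfolding convex_on_def by blast
  then show "f (- (u *\<^sub>R x + v *\<^sub>R y)) \<le> u * f (- x) + v * f (- y)" by simp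
qed

section \<open>Convexity and risk bound\<close>

text \<open>The part of the estimation problem that is common to \<open>Q, q\<close> and their negatives.\<close>

locale quadratic_estimation =
  fixes K :: nat and \<epsilon> \<gamma> \<delta> :: real
    and U :: "(real^'m) set" and V :: "(real^'k) set"
    and M :: "real^'k \<Rightarrow> real^'d^'d"
    and A :: "real^('m::finite + unit)^'d"
    and \<Z> :: "(real^('m::finite + unit)^('m::finite + unit)) set"
    and \<Theta>s :: "real^'d^'d"
  assumes K: "1 \<le> K" and eps: "0 < \<epsilon>" "\<epsilon> < 1"
    and V: "V \<noteq> {}" "compact V"
    and M: "affine_map M" "\<And>v. v \<in> V \<Longrightarrow> psd (M v)"
    and \<Z>: "compact \<Z>" "\<Z> \<noteq> {}" "\<And>Z. Z \<in> \<Z> \<Longrightarrow> psd Z"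
    and U: "\<And>u. u \<in> U \<Longrightarrow> outer_square (vec_snoc u 1) \<in> \<Z>"
    and \<Theta>s: "posdef \<Theta>s" and \<delta>: "0 \<le> \<delta>"
    and M_le: "\<And>v. v \<in> V \<Longrightarrow> M v \<preceq> \<Theta>s"
    and M_\<delta>: "\<And>v. v \<in> V \<Longrightarrow> spectral_norm (psd_sqrt (M v) ** matrix_inv (psd_sqrt \<Theta>s) - mat 1) \<le> \<delta>"
    and \<gamma>: "0 < \<gamma>" "\<gamma> < 1"
begin

abbreviation "adm \<equiv> admissible \<gamma> \<Theta>s"
abbreviation "obj \<equiv> obj_plus K \<epsilon> \<Theta>s \<delta> M A"
abbreviation "Psi \<equiv> Psi_plus K \<epsilon> \<gamma> \<Theta>s \<delta> V \<Z> M A"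

text \<open>The second-moment matrix of \<open>[A [u; 1]; 1]\<close> as a linear function of that of \<open>[u; 1]\<close>.\<close>

definition lift :: "real^('m + unit)^('m + unit) \<Rightarrow> real^('d + unit)^('d + unit)" where
  "lift Z = append_basis_row A ** Z ** transpose (append_basis_row A)"

lemma psd_lift: "Z \<in> \<Z> \<Longrightarrow> psd (lift Z)"
  unfolding lift_def by (rule psd_congruence) (rule \<Z>(3))

lemma lift_outer_square: "lift (outer_square (vec_snoc u 1)) = outer_square (vec_snoc (A *v vec_snoc u 1) 1)"
  by (simp add: lift_def outer_square_congruence append_basis_row_mult_vec)

lemma obj_eq: "obj Q q h H p \<alpha> =
  \<alpha> * Phi \<Theta>s \<delta> (h /\<^sub>R \<alpha>) (H /\<^sub>R \<alpha>) (M (fst p)) (lift (snd p)) - G_fun Q q (fst p) (snd p) + \<alpha> / real K * ln (2 / \<epsilon>)"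
  by (simp add: obj_plus_def lift_def Let_def case_prod_beta)

lemma adm_iff: "\<alpha> \<in> adm H \<longleftrightarrow> 0 < \<alpha> \<and> Phi_dom \<gamma> \<Theta>s (H /\<^sub>R \<alpha>)"
  using Phi_dom_scaleR[OF \<Theta>s] by (auto simp: admissible_eq)

lemma ln_eps: "0 \<le> ln (2 / \<epsilon>)"
  using eps by (intro ln_ge_zero) (simp add: field_simps)

lemma obj_proper:
  assumes H: "symmetric_mat H"
  shows "max_inf_proper (V \<times> \<Z>) (adm H) (obj Q q h H)"
proof (rule max_inf_proper_compact)
  show "compact (V \<times> \<Z>)" "V \<times> \<Z> \<noteq> {}" using V \<Z> by (auto intro: compact_Times)
  show "adm H \<noteq> {}" by (rule admissible_nonempty[OF \<Theta>s \<gamma>(1) H])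
  show "continuous_on (V \<times> \<Z>) (\<lambda>p. obj Q q h H p \<alpha>)" for \<alpha>
    unfolding obj_eq Phi_def Let_def lift_def G_fun_def
    by (intro continuous_intros continuous_on_compose2[OF affine_map_continuous_on[OF M(1), of UNIV]]) auto
  show "bdd_below (obj Q q h H p ` adm H)" if p: "p \<in> V \<times> \<Z>" for p
  proof (rule bdd_belowI2)
    fix \<alpha> assume \<alpha>: "\<alpha> \<in> adm H"
    then have a: "0 < \<alpha>" "Phi_dom \<gamma> \<Theta>s (H /\<^sub>R \<alpha>)" by (auto simp: adm_iff)
    let ?l = "\<lambda>h H. Phi_linear_part \<Theta>s h H (M (fst p)) (lift (snd p))"
    have "?l h H = \<alpha> * ?l (h /\<^sub>R \<alpha>) (H /\<^sub>R \<alpha>)" using a(1) by (simp add: Phi_linear_part_scaleR)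
    also have "\<dots> \<le> \<alpha> * Phi \<Theta>s \<delta> (h /\<^sub>R \<alpha>) (H /\<^sub>R \<alpha>) (M (fst p)) (lift (snd p))"
      using p a by (intro mult_left_mono Phi_ge_linear_part[OF \<Theta>s _ \<delta> \<gamma>(2)] psd_lift) auto
    finally show "?l h H - G_fun Q q (fst p) (snd p) \<le> obj Q q h H p \<alpha>"
      unfolding obj_eq using a(1) ln_eps K by (simp add: add_increasing2)
  qed
qed

text \<open>The perspective argument: with \<open>r = u s + v t\<close>, the point \<open>(h, H) / r\<close> is the convex combination of
  \<open>(h1, H1) / s\<close> and \<open>(h2, H2) / t\<close> with weights \<open>u s / r\<close> and \<open>v t / r\<close>.\<close>

lemma obj_jointly_convex:
  assumes p: "p \<in> V \<times> \<Z>" and s: "s \<in> adm H1" and t: "t \<in> adm H2" and uv: "0 \<le> u" "0 \<le> v" "u + v = 1"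
  shows "u * s + v * t \<in> adm (u *\<^sub>R H1 + v *\<^sub>R H2)"
    and "obj Q q (u *\<^sub>R h1 + v *\<^sub>R h2) (u *\<^sub>R H1 + v *\<^sub>R H2) p (u * s + v * t)
      \<le> u * obj Q q h1 H1 p s + v * obj Q q h2 H2 p t"
proof -
  have s': "0 < s" "Phi_dom \<gamma> \<Theta>s (H1 /\<^sub>R s)" and t': "0 < t" "Phi_dom \<gamma> \<Theta>s (H2 /\<^sub>R t)"
    using s t by (auto simp: adm_iff)
  define r where "r = u * s + v * t"
  have r: "0 < r"
  proof (cases "u = 0")
    case False
    then have "0 < u * s" "0 \<le> v * t" using s' t' uv by auto
    then show ?thesis unfolding r_def by linarith
  qed (use t' uv in \<open>auto simp: r_def\<close>)
  define a where "a = u * s / r"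
  define b where "b = v * t / r"
  have ab: "0 \<le> a" "0 \<le> b" "a + b = 1"
    using r s' t' uv by (auto simp: a_def b_def add_divide_distrib[symmetric] r_def)
  have ab': "a * inverse s = u * inverse r" "b * inverse t = v * inverse r"
    using s'(1) t'(1) by (simp_all add: a_def b_def divide_inverse)
  have comb: "(u *\<^sub>R x + v *\<^sub>R y) /\<^sub>R r = a *\<^sub>R (x /\<^sub>R s) + b *\<^sub>R (y /\<^sub>R t)" for x y :: "'z::real_vector"
    by (simp add: scaleR_add_right ab' mult.commute[of "inverse r"])
  have "Phi_dom (a * \<gamma> + b * \<gamma>) \<Theta>s (a *\<^sub>R (H1 /\<^sub>R s) + b *\<^sub>R (H2 /\<^sub>R t))"
    by (rule Phi_dom_add[OF \<Theta>s s'(2) t'(2) ab(1,2)])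
  moreover have "a * \<gamma> + b * \<gamma> = \<gamma>" using ab(3) by (metis distrib_right mult_1)
  ultimately show "u * s + v * t \<in> adm (u *\<^sub>R H1 + v *\<^sub>R H2)"
    using r by (simp add: adm_iff r_def[symmetric] comb)
  let ?Phi = "\<lambda>h H. Phi \<Theta>s \<delta> h H (M (fst p)) (lift (snd p))"
  have "r * ?Phi (a *\<^sub>R (h1 /\<^sub>R s) + b *\<^sub>R (h2 /\<^sub>R t)) (a *\<^sub>R (H1 /\<^sub>R s) + b *\<^sub>R (H2 /\<^sub>R t))
    \<le> r * (a * ?Phi (h1 /\<^sub>R s) (H1 /\<^sub>R s) + b * ?Phi (h2 /\<^sub>R t) (H2 /\<^sub>R t))"
    using p r by (intro mult_left_mono Phi_convex[OF \<Theta>s _ \<delta> \<gamma>(2) s'(2) t'(2) ab] psd_lift) auto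
  also have "\<dots> = u * (s * ?Phi (h1 /\<^sub>R s) (H1 /\<^sub>R s)) + v * (t * ?Phi (h2 /\<^sub>R t) (H2 /\<^sub>R t))"
  proof -
    have "r * a = u * s" "r * b = v * t" using r by (simp_all add: a_def b_def)
    moreover have "r * (a * x + b * y) = (r * a) * x + (r * b) * y" for x y by (simp add: distrib_left)
    ultimately show ?thesis by (simp only: mult.assoc)
  qed
  finally have Phi_le: "r * ?Phi (a *\<^sub>R (h1 /\<^sub>R s) + b *\<^sub>R (h2 /\<^sub>R t)) (a *\<^sub>R (H1 /\<^sub>R s) + b *\<^sub>R (H2 /\<^sub>R t))
    \<le> u * (s * ?Phi (h1 /\<^sub>R s) (H1 /\<^sub>R s)) + v * (t * ?Phi (h2 /\<^sub>R t) (H2 /\<^sub>R t))" .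
  have G: "G_fun Q q (fst p) (snd p) = u * G_fun Q q (fst p) (snd p) + v * G_fun Q q (fst p) (snd p)"
    using uv(3) by (metis distrib_right mult_1)
  have l: "r / real K * ln (2 / \<epsilon>) = u * (s / real K * ln (2 / \<epsilon>)) + v * (t / real K * ln (2 / \<epsilon>))"
    by (simp add: r_def add_divide_distrib algebra_simps)
  show "obj Q q (u *\<^sub>R h1 + v *\<^sub>R h2) (u *\<^sub>R H1 + v *\<^sub>R H2) p (u * s + v * t)
      \<le> u * obj Q q h1 H1 p s + v * obj Q q h2 H2 p t"
    unfolding r_def[symmetric] obj_eq comb distrib_left right_diff_distrib
    using Phi_le G l by linarith
qed

lemma Psi_convex: "convex_on (UNIV \<times> {H. symmetric_mat H}) (\<lambda>(h, H). Psi Q q h H)"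
proof -
  have "convex_on (UNIV \<times> {H. symmetric_mat H}) (\<lambda>x. max_inf (V \<times> \<Z>) (adm (snd x)) (obj Q q (fst x) (snd x)))"
  proof (rule convex_on_max_inf)
    show "convex (UNIV \<times> {H :: real^'d^'d. symmetric_mat H})" by (intro convex_Times convex_symmetric_mat convex_UNIV)
    show "max_inf_proper (V \<times> \<Z>) (adm (snd x)) (obj Q q (fst x) (snd x))"
      if "x \<in> UNIV \<times> {H. symmetric_mat H}" for x :: "(real^'d) \<times> (real^'d^'d)"
      using that by (auto intro: obj_proper)
  next
    fix x y :: "(real^'d) \<times> (real^'d^'d)" and s t u v :: real and p
    assume *: "p \<in> V \<times> \<Z>" "s \<in> adm (snd x)" "t \<in> adm (snd y)" "0 \<le> u" "0 \<le> v" "u + v = 1"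
    show "\<exists>r\<in>adm (snd (u *\<^sub>R x + v *\<^sub>R y)).
      obj Q q (fst (u *\<^sub>R x + v *\<^sub>R y)) (snd (u *\<^sub>R x + v *\<^sub>R y)) p r
      \<le> u * obj Q q (fst x) (snd x) p s + v * obj Q q (fst y) (snd y) p t"
      using obj_jointly_convex[OF *] by (intro bexI[of _ "u * s + v * t"]) simp_all
  qed
  then show ?thesis by (simp add: Psi_plus_def case_prod_unfold)
qed

text \<open>The infimum over \<open>\<alpha>\<close> need not be attained, so the Chernoff bound is first used at the levels \<open>r + e\<close> with
  \<open>e > 0\<close>. The event at level \<open>r\<close> is the increasing union of those at the levels \<open>r + 1 / (n + 1)\<close>.\<close>

lemma deviation_prob_le:
  assumes H: "symmetric_mat H" and u: "u \<in> U" and v: "v \<in> V" and r: "Psi Q q h H \<le> r"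
  defines "P \<equiv> iid_sample K (gaussian (A *v vec_snoc u 1) (M v))"
  defines "\<phi> \<equiv> \<lambda>z. h \<bullet> z + (1/2) * (z \<bullet> (H *v z))"
  shows "measure P {\<zeta> \<in> space P. F_fun Q q u v + r < (1 / real K) * (\<Sum>i<K. \<phi> (\<zeta> i))} \<le> \<epsilon> / 2"
proof -
  let ?N = "gaussian (A *v vec_snoc u 1) (M v)"
  let ?Z = "outer_square (vec_snoc u 1)"
  let ?F = "F_fun Q q u v"
  let ?T = "\<lambda>\<zeta>. (1 / real K) * (\<Sum>i<K. \<phi> (\<zeta> i))"
  have p: "(v, ?Z) \<in> V \<times> \<Z>" using u v U by auto
  have \<phi>[measurable]: "\<phi> \<in> borel_measurable ?N" unfolding \<phi>_def by measurable
  have strict: "measure P {\<zeta> \<in> space P. ?F + (r + e) < ?T \<zeta>} \<le> \<epsilon> / 2" if e: "0 < e" for e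
  proof -
    have "max_inf (V \<times> \<Z>) (adm H) (obj Q q h H) < r + e" using r e by (simp add: Psi_plus_def)
    then obtain \<alpha> where \<alpha>: "\<alpha> \<in> adm H" "obj Q q h H (v, ?Z) \<alpha> < r + e"
      using max_inf_less_witness[OF obj_proper[OF H] p] by metis
    have a: "0 < \<alpha>" "Phi_dom \<gamma> \<Theta>s (H /\<^sub>R \<alpha>)" using \<alpha>(1) by (auto simp: adm_iff)
    define c where "c = Phi \<Theta>s \<delta> (h /\<^sub>R \<alpha>) (H /\<^sub>R \<alpha>) (M v) (outer_square (vec_snoc (A *v vec_snoc u 1) 1))"
    have "\<phi> z / \<alpha> = (h /\<^sub>R \<alpha>) \<bullet> z + (1/2) * (z \<bullet> ((H /\<^sub>R \<alpha>) *v z))" for z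
      using a(1) by (simp add: \<phi>_def scaleR_matrix_vector field_simps)
    then have "(\<integral>\<^sup>+z. ennreal (exp (\<phi> z / \<alpha>)) \<partial>?N) \<le> ennreal (exp c)"
      unfolding c_def
      by (simp only: gaussian_exp_quad_le_Phi[OF \<Theta>s M(2)[OF v] M_le[OF v] M_\<delta>[OF v] \<gamma>(2) a(2)])
    from iid_chernoff[OF prob_space_gaussian \<phi> K a(1) this]
    have "measure P {\<zeta> \<in> space P. ?F + (r + e) < ?T \<zeta>} \<le> exp (real K * (c - (?F + (r + e)) / \<alpha>))"
      by (simp add: P_def)
    also have "\<dots> \<le> exp (- ln (2 / \<epsilon>))"
    proof -
      have "\<alpha> * c - ?F + \<alpha> / real K * ln (2 / \<epsilon>) < r + e"
        using \<alpha>(2) unfolding obj_eq by (simp add: lift_outer_square G_fun_outer_square c_def)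
      then have "(real K / \<alpha>) * (\<alpha> * c - ?F + \<alpha> / real K * ln (2 / \<epsilon>)) \<le> (real K / \<alpha>) * (r + e)"
        using a(1) by (intro mult_left_mono) auto
      moreover have "(real K / \<alpha>) * (\<alpha> * c - ?F + \<alpha> / real K * ln (2 / \<epsilon>))
          = real K * (c - ?F / \<alpha>) + ln (2 / \<epsilon>)"
        using a(1) K by (simp add: field_simps)
      moreover have "real K * (c - (?F + (r + e)) / \<alpha>) = real K * (c - ?F / \<alpha>) - (real K / \<alpha>) * (r + e)"
        by (simp add: add_divide_distrib algebra_simps)
      ultimately have "real K * (c - (?F + (r + e)) / \<alpha>) \<le> - ln (2 / \<epsilon>)" by linarith
      then show ?thesis by simp
    qed
    also have "\<dots> = \<epsilon> / 2" using eps by (simp add: exp_minus)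
    finally show ?thesis .
  qed
  interpret P: prob_space P unfolding P_def iid_sample_def by (rule prob_space_PiM) (rule prob_space_gaussian)
  define E where "E n = {\<zeta> \<in> space P. ?F + (r + 1 / real (Suc n)) < ?T \<zeta>}" for n
  have E: "E n \<in> sets P" for n unfolding E_def P_def iid_sample_def by measurable
  have "incseq E"
  proof (rule incseq_SucI, rule subsetI)
    fix n \<zeta> assume "\<zeta> \<in> E n"
    moreover have "1 / real (Suc (Suc n)) \<le> 1 / real (Suc n)" by (rule divide_left_mono) auto
    ultimately show "\<zeta> \<in> E (Suc n)" unfolding E_def by (auto simp del: of_nat_Suc)
  qed
  then have "(\<lambda>n. measure P (E n)) \<longlonglongrightarrow> measure P (\<Union>n. E n)"
    using E by (intro P.finite_Lim_measure_incseq) auto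
  moreover have "(\<Union>n. E n) = {\<zeta> \<in> space P. ?F + r < ?T \<zeta>}"
  proof (intro equalityI subsetI)
    fix \<zeta> assume "\<zeta> \<in> {\<zeta> \<in> space P. ?F + r < ?T \<zeta>}"
    then have "\<zeta> \<in> space P" "0 < ?T \<zeta> - (?F + r)" by auto
    moreover obtain n where "1 / real (Suc n) < ?T \<zeta> - (?F + r)"
      using nat_approx_posE[OF \<open>0 < ?T \<zeta> - (?F + r)\<close>] by blast
    ultimately show "\<zeta> \<in> (\<Union>n. E n)" unfolding E_def by (intro UN_I[of n]) (auto simp del: of_nat_Suc)
  next
    fix \<zeta> assume "\<zeta> \<in> (\<Union>n. E n)"
    then obtain n where "\<zeta> \<in> space P" "?F + (r + 1 / real (Suc n)) < ?T \<zeta>" by (auto simp: E_def simp del: of_nat_Suc)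
    moreover have "0 < 1 / real (Suc n)" by simp
    ultimately have "?F + r < ?T \<zeta>" by linarith
    with \<open>\<zeta> \<in> space P\<close> show "\<zeta> \<in> {\<zeta> \<in> space P. ?F + r < ?T \<zeta>}" by blast
  qed
  ultimately have "(\<lambda>n. measure P (E n)) \<longlonglongrightarrow> measure P {\<zeta> \<in> space P. ?F + r < ?T \<zeta>}" by simp
  moreover have "measure P (E n) \<le> \<epsilon> / 2" for n unfolding E_def by (rule strict) simp
  ultimately show ?thesis by (intro LIMSEQ_le_const2) auto
qed

text \<open>Two one-sided deviations, each of probability at most \<open>\<epsilon> / 2\<close>; the shift \<open>\<kappa>\<close> balances the two levels.\<close>

lemma risk_bound_quad_estimate:
  assumes H: "symmetric_mat H"
    and plus: "Psi Q q h H \<le> \<rho> - \<kappa>" and minus: "Psi (- Q) (- q) (- h) (- H) \<le> \<rho> + \<kappa>"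
  shows "risk_bound K \<epsilon> U V A M (F_fun Q q) (quad_estimate K h H \<kappa>) \<rho>"
  unfolding risk_bound_def Let_def
proof (intro ballI)
  fix u v assume u: "u \<in> U" and v: "v \<in> V"
  let ?N = "gaussian (A *v vec_snoc u 1) (M v)"
  let ?P = "iid_sample K ?N"
  let ?F = "F_fun Q q u v"
  let ?s = "\<lambda>h H \<zeta>. (1 / real K) * (\<Sum>i<K. h \<bullet> \<zeta> i + (1/2) * (\<zeta> i \<bullet> (H *v \<zeta> i)))"
  interpret P: prob_space ?P unfolding iid_sample_def by (rule prob_space_PiM) (rule prob_space_gaussian)
  have meas: "{\<zeta> \<in> space ?P. c < ?s h H \<zeta>} \<in> sets ?P" for c h H
    unfolding iid_sample_def by measurable
  have "(- h) \<bullet> z + (1/2) * (z \<bullet> ((- H) *v z)) = - (h \<bullet> z + (1/2) * (z \<bullet> (H *v z)))" for z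
    by (simp add: matrix_vector_mult_uminus)
  then have neg: "?s (- h) (- H) \<zeta> = - ?s h H \<zeta>" for \<zeta>
    by (simp only: sum_negf mult_minus_right)
  let ?A = "{\<zeta> \<in> space ?P. ?F + (\<rho> - \<kappa>) < ?s h H \<zeta>}"
  let ?B = "{\<zeta> \<in> space ?P. F_fun (- Q) (- q) u v + (\<rho> + \<kappa>) < ?s (- h) (- H) \<zeta>}"
  have sub: "{\<zeta> \<in> space ?P. \<rho> < \<bar>?F - quad_estimate K h H \<kappa> \<zeta>\<bar>} \<subseteq> ?A \<union> ?B"
    unfolding neg F_fun_uminus quad_estimate_def by auto
  have "measure ?P {\<zeta> \<in> space ?P. \<rho> < \<bar>?F - quad_estimate K h H \<kappa> \<zeta>\<bar>} \<le> measure ?P (?A \<union> ?B)"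
    using meas by (intro P.finite_measure_mono sub sets.Un)
  also have "\<dots> \<le> measure ?P ?A + measure ?P ?B" by (rule measure_Un_le) (rule meas)+
  also have "\<dots> \<le> \<epsilon> / 2 + \<epsilon> / 2"
    using deviation_prob_le[OF H u v plus] deviation_prob_le[OF symmetric_mat_uminus[OF H] u v minus]
    by (intro add_mono)
  finally show "measure ?P {\<zeta> \<in> space ?P. \<rho> < \<bar>?F - quad_estimate K h H \<kappa> \<zeta>\<bar>} \<le> \<epsilon>" by simp
qed

end

lemma measurable_quad_estimate: "quad_estimate K h H \<kappa> \<in> borel_measurable (Pi\<^sub>M {..<K} (\<lambda>_. borel))"
  unfolding quad_estimate_def by measurable

lemma eps_risk_le: "risk_bound K \<epsilon> U V A M F g \<rho> \<Longrightarrow> eps_risk K \<epsilon> U V A M F g \<le> ereal \<rho>"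
  unfolding eps_risk_def by (rule Inf_lower) simp

theorem proposition5p1:
  fixes K :: nat and \<epsilon> \<gamma> \<delta> :: real
    and U :: "(real^'m) set" and V :: "(real^'k) set"
    and M :: "real^'k \<Rightarrow> real^'d^'d"
    and A :: "real^('m::finite + unit)^'d"
    and Q :: "real^('m::finite + unit)^('m::finite + unit)" and q :: "real^'k"
    and \<Z> :: "(real^('m::finite + unit)^('m::finite + unit)) set"
    and \<Theta>s :: "real^'d^'d"
  assumes "1 \<le> K" and "0 < \<epsilon>" and "\<epsilon> < 1"
    and "U \<noteq> {}" and "bounded U"
    and "V \<noteq> {}" and "convex V" and "compact V"
    and "affine_map M" and "\<And>v. symmetric_mat (M v)"
    and "convex (M ` V)" and "compact (M ` V)" and "\<And>\<Theta>. \<Theta> \<in> M ` V \<Longrightarrow> psd \<Theta>"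
    and "symmetric_mat Q"
    and "convex \<Z>" and "compact \<Z>"
    and "\<And>Z. Z \<in> \<Z> \<Longrightarrow> psd Z \<and> Z $ Inr () $ Inr () = 1"
    and "\<And>u. u \<in> U \<Longrightarrow> outer_square (vec_snoc u 1) \<in> \<Z>"
    and "posdef \<Theta>s" and "0 \<le> \<delta>" and "\<delta> \<le> 2"
    and "\<And>\<Theta>. \<Theta> \<in> M ` V \<Longrightarrow> \<Theta> \<preceq> \<Theta>s"
    and "\<And>\<Theta>. \<Theta> \<in> M ` V \<Longrightarrow>
           spectral_norm (psd_sqrt \<Theta> ** matrix_inv (psd_sqrt \<Theta>s) - mat 1) \<le> \<delta>"
    and "0 < \<gamma>" and "\<gamma> < 1"
  shows
    "let Psi_p = Psi_plus K \<epsilon> \<gamma> \<Theta>s \<delta> V \<Z> M A Q q;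
         Psi_m = Psi_minus K \<epsilon> \<gamma> \<Theta>s \<delta> V \<Z> M A Q q;
         F = F_fun Q q
     in
       (\<forall>h H. symmetric_mat H \<longrightarrow>
          max_inf_proper (V \<times> \<Z>) (admissible \<gamma> \<Theta>s H) (obj_plus K \<epsilon> \<Theta>s \<delta> M A Q q h H) \<and>
          max_inf_proper (V \<times> \<Z>) (admissible \<gamma> \<Theta>s H) (obj_minus K \<epsilon> \<Theta>s \<delta> M A Q q h H)) \<and>
       convex_on (UNIV \<times> {H. symmetric_mat H}) (\<lambda>(h, H). Psi_p h H) \<and>
       convex_on (UNIV \<times> {H. symmetric_mat H}) (\<lambda>(h, H). Psi_m h H) \<and>
       (\<forall>h H \<rho> \<kappa>. symmetric_mat H \<longrightarrow> Psi_p h H \<le> \<rho> - \<kappa> \<longrightarrow> Psi_m h H \<le> \<rho> + \<kappa> \<longrightarrow>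
          quad_estimate K h H \<kappa> \<in> borel_measurable (Pi\<^sub>M {..<K} (\<lambda>_. borel)) \<and>
          eps_risk K \<epsilon> U V A M F (quad_estimate K h H \<kappa>) \<le> ereal \<rho> \<and>
          (\<forall>u\<in>U. \<forall>v\<in>V.
             let P = iid_sample K (gaussian (A *v vec_snoc u 1) (M v))
             in measure P {\<zeta> \<in> space P. \<bar>F u v - quad_estimate K h H \<kappa> \<zeta>\<bar> > \<rho>} \<le> \<epsilon>)) \<and>
       (\<forall>h H. symmetric_mat H \<longrightarrow>
          (let \<rho> = (1/2) * (Psi_p h H + Psi_m h H);
               \<kappa> = (1/2) * (Psi_m h H - Psi_p h H)
           in eps_risk K \<epsilon> U V A M F (quad_estimate K h H \<kappa>) \<le> ereal \<rho> \<and>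
              risk_bound K \<epsilon> U V A M F (quad_estimate K h H \<kappa>) \<rho>))"
proof -
  have "\<Z> \<noteq> {}" using assms(4,18) by blast
  then interpret quadratic_estimation K \<epsilon> \<gamma> \<delta> U V M A \<Z> \<Theta>s
    by unfold_locales (use assms in auto)
  note minus = obj_minus_eq_obj_plus Psi_minus_eq_Psi_plus[OF \<Theta>s]
  have proper: "max_inf_proper (V \<times> \<Z>) (adm H) (obj Q q h H)"
    "max_inf_proper (V \<times> \<Z>) (adm H) (obj (- Q) (- q) (- h) (- H))" if "symmetric_mat H" for h H
    using obj_proper[OF that] obj_proper[OF symmetric_mat_uminus[OF that]] admissible_uminus[OF \<Theta>s] by auto
  have "convex_on (UNIV \<times> {H. symmetric_mat H}) (\<lambda>x. (\<lambda>(h, H). Psi (- Q) (- q) h H) (- x))"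
    by (rule convex_on_compose_uminus[OF Psi_convex]) (auto intro: symmetric_mat_uminus)
  then have convex_minus: "convex_on (UNIV \<times> {H. symmetric_mat H}) (\<lambda>(h, H). Psi (- Q) (- q) (- h) (- H))"
    by (simp add: case_prod_unfold)
  have risk: "risk_bound K \<epsilon> U V A M (F_fun Q q) (quad_estimate K h H \<kappa>) \<rho>"
    if "symmetric_mat H" "Psi Q q h H \<le> \<rho> - \<kappa>" "Psi (- Q) (- q) (- h) (- H) \<le> \<rho> + \<kappa>" for h H \<rho> \<kappa>
    by (rule risk_bound_quad_estimate[OF that])
  have special: "risk_bound K \<epsilon> U V A M (F_fun Q q)
      (quad_estimate K h H ((1/2) * (Psi (- Q) (- q) (- h) (- H) - Psi Q q h H)))
      ((1/2) * (Psi Q q h H + Psi (- Q) (- q) (- h) (- H)))" if "symmetric_mat H" for h H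
    by (rule risk[OF that]) (simp_all add: field_simps)
  show ?thesis
    unfolding Let_def minus
  proof (intro conjI allI impI)
    fix h H \<rho> \<kappa>
    assume "symmetric_mat H" "Psi Q q h H \<le> \<rho> - \<kappa>" "Psi (- Q) (- q) (- h) (- H) \<le> \<rho> + \<kappa>"
    note rb = risk[OF this]
    show "eps_risk K \<epsilon> U V A M (F_fun Q q) (quad_estimate K h H \<kappa>) \<le> ereal \<rho>"
      by (rule eps_risk_le[OF rb])
    show "\<forall>u\<in>U. \<forall>v\<in>V. measure (iid_sample K (gaussian (A *v vec_snoc u 1) (M v)))
        {\<zeta> \<in> space (iid_sample K (gaussian (A *v vec_snoc u 1) (M v))).
          \<rho> < \<bar>F_fun Q q u v - quad_estimate K h H \<kappa> \<zeta>\<bar>} \<le> \<epsilon>"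
      using rb by (simp only: risk_bound_def Let_def)
  qed (use proper Psi_convex convex_minus special in \<open>simp_all only: measurable_quad_estimate eps_risk_le\<close>)
qed


end
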